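(* Fix integers $d\ge 1$, $n\ge k\ge 2$. For $X=\{x_i\}_{i\in[n]}\in(\mathbb{R}^d)^n$ and $\Gamma\in\Pi(n,k)$ let $\Delta$, $r$, $\operatorname{prox}(X,\Gamma)$, $\pi_{\min}:=\frac1n\min_{S\in\Gamma}|S|$ and $\pi_{\max}:=\frac1n\max_{S\in\Gamma}|S|$ be as in the context. There exists an explicit function $C\colon(\mathbb{R}^d)^n\times\Pi(n,k)\to[0,\infty]$ (a "shape parameter"), which depends on $(X,\Gamma)$ only through the six quantities $d$, $\Delta/r$, $\operatorname{prox}(X,\Gamma)/r$, $k$, $\pi_{\min}$, $\pi_{\max}$, such that: (a) If $X\in(\mathbb{R}^d)^n$ and $\Gamma\in\Pi(n,k)$ satisfy $\operatorname{prox}(X,\Gamma)>0$ and $r\le \Delta/2$, then $C(X,\Gamma)<\infty$, and for every $\epsilon\in(0,\frac12)$ and every Bernoulli rate $p$ with $\mathbb{E}|W|=pn> C(X,\Gamma)\log(1/\epsilon)$, the sketch-and-solve procedure (described in the context) exactly recovers $\Gamma$ from $X$ with probability at least $1-\epsilon$ (the randomness being that of the Bernoulli process defining $W$). (b) $C(X,\Gamma)$ is directly related to (nondecreasing in) $d$, $k$ and $\pi_{\max}$, and inversely related to (nonincreasing in) $\Delta/r$, $\operatorname{prox}(X,\Gamma)/r$ and $\pi_{\min}$.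
   Context: $[n]=\{1,\dots,n\}$. $\Pi(n,k)$ is the set of partitions of $[n]$ into $k$ nonempty sets. For a tuple $X=\{x_i\}_{i\in[n]}$ in $\mathbb{R}^d$ and nonempty $S\subseteq[n]$, $c_S:=\frac1{|S|}\sum_{i\in S}x_i$. For $\Gamma\in\Pi(n,k)$ and $S,T\in\Gamma$, $S\ne T$, define $\alpha_{ST}:=\min_{i\in S}\langle x_i-\frac{c_S+c_T}{2},\frac{c_S-c_T}{\|c_S-c_T\|}\rangle$ and $\beta_{ST}:=\frac12\big((\frac1{|S|}+\frac1{|T|})\sum_{R\in\Gamma}\|X_R\|_{2\to2}^2\big)^{1/2}$, where $X_R$ is the $d\times n$ matrix whose $i$-th column is $x_i-c_R$ if $i\in R$ and $0$ otherwise. Put $\operatorname{prox}(X,\Gamma):=\min_{S\ne T\in\Gamma}(\alpha_{ST}-\beta_{ST})$, $\Delta:=\min_{S\ne T\in\Gamma}\|c_S-c_T\|$, $r:=\max_{S\in\Gamma}\max_{i\in S}\|x_i-c_S\|$. For a tuple $Y=\{y_j\}_{j\in[m]}$, let $D_Y\in\mathbb{R}^{m\times m}$, $(D_Y)_{ij}=\|y_i-y_j\|^2$; the Peng–Wei semidefinite relaxation is: minimize $\frac1{2m}\operatorname{tr}(D_YZ)$ over $Z\in\mathcal{Z}(m,k):=\{Z\in\mathbb{R}^{m\times m}: Z\mathbf 1=\mathbf 1,\ \operatorname{tr}Z=k,\ Z\ge 0 \text{ entrywise},\ Z\succeq 0\}$. For a partition $\Gamma$, $Z_\Gamma:=\sum_{S\in\Gamma}\frac1{|S|}1_S1_S^\top$.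 Sketch-and-solve procedure with rate $p\in(0,1]$: draw $W\subseteq[n]$ by including each index independently with probability $p$; put $X'=\{x_i\}_{i\in W}$; solve the Peng–Wei relaxation for $X'$ to obtain a partition $\Gamma'$ of $W$ into $k$ sets (whose matrix $Z_{\Gamma'}$ is the SDP minimizer); compute centroids $c_{S'}$, $S'\in\Gamma'$; output the partition of $[n]$ obtained by assigning each $x_i$ to the closest centroid $c_{S'}$. "Exactly recovers $\Gamma$" means the output equals $\Gamma$. *)

theory Defs
  imports "HOL-Probability.Probability"
begin

text \<open>Points of R^d are represented as functions nat => real, only coordinates j < d
  being relevant. A data tuple X assigns to each index i the point X i.\<close>

definition vinner :: "nat \<Rightarrow> (nat \<Rightarrow> real) \<Rightarrow> (nat \<Rightarrow> real) \<Rightarrow> real" where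
  "vinner d u v = (\<Sum>j<d. u j * v j)"

definition vnorm :: "nat \<Rightarrow> (nat \<Rightarrow> real) \<Rightarrow> real" where
  "vnorm d u = sqrt (vinner d u u)"

definition is_partition :: "nat set \<Rightarrow> nat \<Rightarrow> nat set set \<Rightarrow> bool" where
  "is_partition A k \<Gamma> \<longleftrightarrow> \<Union>\<Gamma> = A \<and> (\<forall>S\<in>\<Gamma>. S \<noteq> {}) \<and>
     (\<forall>S\<in>\<Gamma>. \<forall>T\<in>\<Gamma>. S \<noteq> T \<longrightarrow> S \<inter> T = {}) \<and> card \<Gamma> = k"

definition centroid :: "(nat \<Rightarrow> nat \<Rightarrow> real) \<Rightarrow> nat set \<Rightarrow> (nat \<Rightarrow> real)" where
  "centroid X S = (\<lambda>j. (\<Sum>i\<in>S. X i j) / real (card S))"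

definition alpha :: "nat \<Rightarrow> (nat \<Rightarrow> nat \<Rightarrow> real) \<Rightarrow> nat set \<Rightarrow> nat set \<Rightarrow> real" where
  "alpha d X S T = Min ((\<lambda>i. vinner d
      (\<lambda>j. X i j - (centroid X S j + centroid X T j) / 2)
      (\<lambda>j. (centroid X S j - centroid X T j) /
            vnorm d (\<lambda>l. centroid X S l - centroid X T l))) ` S)"

text \<open>Spectral norm of the d x |A| matrix X_R (columns x_i - c_R for i in R, zero otherwise).\<close>
definition opnorm :: "nat \<Rightarrow> nat set \<Rightarrow> (nat \<Rightarrow> nat \<Rightarrow> real) \<Rightarrow> nat set \<Rightarrow> real" where
  "opnorm d A X R = Sup {vnorm d (\<lambda>j. \<Sum>i\<in>R. (X i j - centroid X R j) * v i) | v.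
                          (\<Sum>i\<in>A. (v i)\<^sup>2) \<le> 1}"

definition beta :: "nat \<Rightarrow> nat set \<Rightarrow> (nat \<Rightarrow> nat \<Rightarrow> real) \<Rightarrow> nat set set \<Rightarrow> nat set \<Rightarrow> nat set \<Rightarrow> real" where
  "beta d A X \<Gamma> S T = 1/2 * sqrt ((1 / real (card S) + 1 / real (card T)) *
                          (\<Sum>R\<in>\<Gamma>. (opnorm d A X R)\<^sup>2))"

definition prox :: "nat \<Rightarrow> nat set \<Rightarrow> (nat \<Rightarrow> nat \<Rightarrow> real) \<Rightarrow> nat set set \<Rightarrow> real" where
  "prox d A X \<Gamma> = Min {alpha d X S T - beta d A X \<Gamma> S T | S T. S \<in> \<Gamma> \<and> T \<in> \<Gamma> \<and> S \<noteq> T}"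

definition Delta :: "nat \<Rightarrow> (nat \<Rightarrow> nat \<Rightarrow> real) \<Rightarrow> nat set set \<Rightarrow> real" where
  "Delta d X \<Gamma> = Min {vnorm d (\<lambda>j. centroid X S j - centroid X T j) | S T.
                        S \<in> \<Gamma> \<and> T \<in> \<Gamma> \<and> S \<noteq> T}"

definition rad :: "nat \<Rightarrow> (nat \<Rightarrow> nat \<Rightarrow> real) \<Rightarrow> nat set set \<Rightarrow> real" where
  "rad d X \<Gamma> = Max {vnorm d (\<lambda>j. X i j - centroid X S j) | S i. S \<in> \<Gamma> \<and> i \<in> S}"

definition pi_min :: "nat \<Rightarrow> nat set set \<Rightarrow> real" where
  "pi_min n \<Gamma> = real (Min (card ` \<Gamma>)) / real n"

definition pi_max :: "nat \<Rightarrow> nat set set \<Rightarrow> real" where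
  "pi_max n \<Gamma> = real (Max (card ` \<Gamma>)) / real n"

text \<open>Peng--Wei SDP for the subtuple indexed by W; matrices are functions nat => nat => real,
  indexed by W x W and required to vanish outside W x W.\<close>
definition sqdist :: "nat \<Rightarrow> (nat \<Rightarrow> nat \<Rightarrow> real) \<Rightarrow> nat \<Rightarrow> nat \<Rightarrow> real" where
  "sqdist d X i j = (vnorm d (\<lambda>l. X i l - X j l))\<^sup>2"

definition pw_feasible :: "nat set \<Rightarrow> nat \<Rightarrow> (nat \<Rightarrow> nat \<Rightarrow> real) \<Rightarrow> bool" where
  "pw_feasible W k Z \<longleftrightarrow>
     (\<forall>i j. (i \<notin> W \<or> j \<notin> W) \<longrightarrow> Z i j = 0) \<and>
     (\<forall>i\<in>W. \<forall>j\<in>W. Z i j = Z j i) \<and>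
     (\<forall>i\<in>W. (\<Sum>j\<in>W. Z i j) = 1) \<and>
     (\<Sum>i\<in>W. Z i i) = real k \<and>
     (\<forall>i\<in>W. \<forall>j\<in>W. Z i j \<ge> 0) \<and>
     (\<forall>v. (\<Sum>i\<in>W. \<Sum>j\<in>W. v i * Z i j * v j) \<ge> 0)"

definition pw_objective :: "nat \<Rightarrow> (nat \<Rightarrow> nat \<Rightarrow> real) \<Rightarrow> nat set \<Rightarrow> (nat \<Rightarrow> nat \<Rightarrow> real) \<Rightarrow> real" where
  "pw_objective d X W Z = 1 / (2 * real (card W)) * (\<Sum>i\<in>W. \<Sum>j\<in>W. sqdist d X i j * Z i j)"

definition pw_unique_minimizer :: "nat \<Rightarrow> (nat \<Rightarrow> nat \<Rightarrow> real) \<Rightarrow> nat set \<Rightarrow> nat \<Rightarrow> (nat \<Rightarrow> nat \<Rightarrow> real) \<Rightarrow> bool" where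
  "pw_unique_minimizer d X W k Z \<longleftrightarrow> pw_feasible W k Z \<and>
     (\<forall>Z'. pw_feasible W k Z' \<and> Z' \<noteq> Z \<longrightarrow> pw_objective d X W Z < pw_objective d X W Z')"

definition Zmat :: "nat set set \<Rightarrow> nat \<Rightarrow> nat \<Rightarrow> real" where
  "Zmat \<Gamma> i j = (\<Sum>S\<in>\<Gamma>. if i \<in> S \<and> j \<in> S then 1 / real (card S) else 0)"

definition assigned :: "nat \<Rightarrow> nat \<Rightarrow> (nat \<Rightarrow> nat \<Rightarrow> real) \<Rightarrow> nat set set \<Rightarrow> nat set \<Rightarrow> nat set" where
  "assigned d n X \<Gamma>' S' = {i \<in> {1..n}. \<forall>T'\<in>\<Gamma>'. T' \<noteq> S' \<longrightarrow>
      vnorm d (\<lambda>j. X i j - centroid X S' j) < vnorm d (\<lambda>j. X i j - centroid X T' j)}"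

definition sketch_recovers :: "nat \<Rightarrow> nat \<Rightarrow> nat \<Rightarrow> (nat \<Rightarrow> nat \<Rightarrow> real) \<Rightarrow> nat set set \<Rightarrow> nat set \<Rightarrow> bool" where
  "sketch_recovers d n k X \<Gamma> W \<longleftrightarrow>
     (\<exists>\<Gamma>'. is_partition W k \<Gamma>' \<and> pw_unique_minimizer d X W k (Zmat \<Gamma>') \<and>
        (\<forall>i\<in>{1..n}. \<exists>S'\<in>\<Gamma>'. i \<in> assigned d n X \<Gamma>' S') \<and>
        assigned d n X \<Gamma>' ` \<Gamma>' = \<Gamma>)"

definition bernoulli_sample :: "nat \<Rightarrow> real \<Rightarrow> nat set pmf" where
  "bernoulli_sample n p = map_pmf (\<lambda>b. {i \<in> {1..n}. b i}) (Pi_pmf {1..n} False (\<lambda>_. bernoulli_pmf p))"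

end

theory Submission
  imports Defs
begin

text \<open>The deterministic part is a dual certificate for the Peng--Wei program. Write
  \<open>u\<^sub>i = x\<^sub>i - c\<^sub>S\<close> for \<open>i \<in> S\<close>, and let \<open>z/2\<close> bound the sum over the clusters of the squared
  operator norms. With \<open>\<lambda>\<^sub>i = |u\<^sub>i|\<^sup>2 + z/(2|S|)\<close>, the matrix \<open>D - \<lambda>1\<^sup>T - 1\<lambda>\<^sup>T + zI\<close> splits as \<open>Q + B\<close>, where the
  \<open>(S,T)\<close> block of \<open>Q\<close> is that of \<open>z(I - Z\<^sub>\<Gamma>)\<close> minus \<open>2\<langle>u\<^sub>i, H u\<^sub>j\<rangle>\<close>, \<open>H\<close> being the
  reflection along \<open>c\<^sub>S - c\<^sub>T\<close>. By Cauchy--Schwarz \<open>Q\<close> is positive semidefinite, and \<open>B\<close> vanishes on the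
  diagonal blocks and equals \<open>4(\<alpha>\<^sub>i\<alpha>\<^sub>j - \<beta>\<^sub>S\<^sub>T\<^sup>2) > 0\<close> elsewhere, where \<open>\<alpha>\<^sub>i\<close> is the quantity minimised
  in \<open>\<alpha>\<^sub>S\<^sub>T\<close>.

  For the random part, a Chernoff bound controls the sizes, the means and the entries of the covariance
  matrices of the sampled clusters up to an error \<open>\<eta>pn\<close>. This moves the centroids by a small multiple
  of \<open>r\<close>, hence \<open>\<alpha>\<close> and \<open>\<beta>\<close> by less than half of the proximity; the perturbed separation
  also shows that every point stays closest to the centroid of its own cluster.\<close>

section \<open>Inner products and positive semidefinite matrices\<close>

lemma vinner_commute: "vinner d u v = vinner d v u"
  by (simp add: vinner_def mult.commute)

lemma vinner_add_left: "vinner d (\<lambda>j. a j + b j) v = vinner d a v + vinner d b v"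
  by (simp add: vinner_def algebra_simps sum.distrib)

lemma vinner_add_right: "vinner d v (\<lambda>j. a j + b j) = vinner d v a + vinner d v b"
  by (simp add: vinner_def algebra_simps sum.distrib)

lemma vinner_diff_left: "vinner d (\<lambda>j. a j - b j) v = vinner d a v - vinner d b v"
  by (simp add: vinner_def algebra_simps sum_subtractf)

lemma vinner_diff_right: "vinner d v (\<lambda>j. a j - b j) = vinner d v a - vinner d v b"
  by (simp add: vinner_def algebra_simps sum_subtractf)

lemma vinner_scale_left: "vinner d (\<lambda>j. c * a j) v = c * vinner d a v"
  by (simp add: vinner_def algebra_simps sum_distrib_left)

lemma vinner_scale_right: "vinner d v (\<lambda>j. c * a j) = c * vinner d v a"
  by (simp add: vinner_def algebra_simps sum_distrib_left)

lemma vinner_divide_left: "vinner d (\<lambda>j. a j / c) v = vinner d a v / c"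
  by (simp add: vinner_def sum_divide_distrib)

lemma vinner_divide_right: "vinner d v (\<lambda>j. a j / c) = vinner d v a / c"
  by (simp add: vinner_def sum_divide_distrib)

lemma vinner_sum_left: "vinner d (\<lambda>j. \<Sum>i\<in>S. q i * u i j) v = (\<Sum>i\<in>S. q i * vinner d (u i) v)"
proof -
  have "vinner d (\<lambda>j. \<Sum>i\<in>S. q i * u i j) v = (\<Sum>j<d. \<Sum>i\<in>S. q i * (u i j * v j))"
    by (simp add: vinner_def sum_distrib_right mult.assoc)
  also have "\<dots> = (\<Sum>i\<in>S. q i * vinner d (u i) v)"
    by (subst sum.swap) (simp add: vinner_def sum_distrib_left)
  finally show ?thesis .
qed

lemma vinner_sum_right: "vinner d v (\<lambda>j. \<Sum>i\<in>S. q i * u i j) = (\<Sum>i\<in>S. q i * vinner d v (u i))"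
  using vinner_sum_left[of d q u S v] by (simp add: vinner_commute)

lemmas vinner_linear = vinner_add_left vinner_add_right vinner_diff_left vinner_diff_right
  vinner_scale_left vinner_scale_right vinner_divide_left vinner_divide_right

lemma vinner_self_nonneg: "0 \<le> vinner d u u"
  by (simp add: vinner_def sum_nonneg)

lemma vnorm_nonneg: "0 \<le> vnorm d u"
  by (simp add: vnorm_def vinner_self_nonneg)

lemma vnorm_squared: "(vnorm d u)\<^sup>2 = vinner d u u"
  by (simp add: vnorm_def vinner_self_nonneg)

lemma vnorm_eq_L2_set: "vnorm d u = L2_set u {..<d}"
  by (simp add: vnorm_def vinner_def L2_set_def power2_eq_square)

lemma vnorm_triangle: "vnorm d (\<lambda>j. u j + v j) \<le> vnorm d u + vnorm d v"
  by (simp add: vnorm_eq_L2_set L2_set_triangle_ineq)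

lemma vnorm_diff_commute: "vnorm d (\<lambda>j. u j - v j) = vnorm d (\<lambda>j. v j - u j)"
  by (simp add: vnorm_def vinner_linear vinner_commute)

lemma vnorm_diff_triangle:
  "vnorm d (\<lambda>j. u j - w j) \<le> vnorm d (\<lambda>j. u j - v j) + vnorm d (\<lambda>j. v j - w j)"
  using vnorm_triangle[of d "\<lambda>j. u j - v j" "\<lambda>j. v j - w j"] by simp

lemma abs_vinner_le_vnorm: "\<bar>vinner d u v\<bar> \<le> vnorm d u * vnorm d v"
proof -
  have "\<bar>vinner d u v\<bar> \<le> (\<Sum>j<d. \<bar>u j\<bar> * \<bar>v j\<bar>)"
    unfolding vinner_def abs_mult[symmetric] by (rule sum_abs)
  then show ?thesis
    using L2_set_mult_ineq[of u v "{..<d}"] by (simp add: vnorm_eq_L2_set)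
qed

lemma vinner_le_vnorm: "vinner d u v \<le> vnorm d u * vnorm d v"
  using abs_vinner_le_vnorm abs_le_D1 by blast

lemma abs_component_le_vnorm: "j < d \<Longrightarrow> \<bar>u j\<bar> \<le> vnorm d u"
  unfolding vnorm_eq_L2_set L2_set_def
  by (rule real_le_rsqrt) (simp add: member_le_sum[of j "{..<d}" "\<lambda>i. (u i)\<^sup>2"])

text \<open>Cholesky factorisation by induction on \<open>W\<close>: splitting off the index
  \<open>a\<close> leaves the Schur complement \<open>Y\<close>, which is again positive
  semidefinite, and the row of \<open>a\<close> supplies one more vector.\<close>

lemma psd_gram:
  fixes Z :: "'a \<Rightarrow> 'a \<Rightarrow> real"
  assumes "finite W"
    and "\<And>i j. i \<in> W \<Longrightarrow> j \<in> W \<Longrightarrow> Z i j = Z j i"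
    and "\<And>v. 0 \<le> (\<Sum>i\<in>W. \<Sum>j\<in>W. v i * Z i j * v j)"
  shows "\<exists>q. \<forall>i\<in>W. \<forall>j\<in>W. Z i j = (\<Sum>m\<in>W. q m i * q m j)"
  using assms
proof (induction W arbitrary: Z rule: finite_induct)
  case empty
  then show ?case by simp
next
  case (insert a W Z)
  note sym = insert.prems(1) and psd = insert.prems(2)
  have form: "(\<Sum>i\<in>insert a W. \<Sum>j\<in>insert a W. v i * Z i j * v j) =
      (v a)\<^sup>2 * Z a a + 2 * v a * (\<Sum>j\<in>W. Z a j * v j) + (\<Sum>i\<in>W. \<Sum>j\<in>W. v i * Z i j * v j)" for v
  proof -
    have "(\<Sum>i\<in>W. v i * Z i a * v a) = v a * (\<Sum>j\<in>W. Z a j * v j)"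
      unfolding sum_distrib_left by (rule sum.cong) (use sym in \<open>auto simp: algebra_simps\<close>)
    moreover have "(\<Sum>j\<in>W. v a * Z a j * v j) = v a * (\<Sum>j\<in>W. Z a j * v j)"
      by (simp add: sum_distrib_left algebra_simps)
    ultimately show ?thesis
      using insert.hyps by (simp add: sum.distrib power2_eq_square algebra_simps)
  qed
  have aa: "0 \<le> Z a a"
  proof -
    have "(\<Sum>i\<in>W. \<Sum>j\<in>W. of_bool (i = a) * Z i j * of_bool (j = a)) = 0"
      "(\<Sum>j\<in>W. Z a j * of_bool (j = a)) = 0"
      using insert.hyps by (auto intro!: sum.neutral)
    with psd[of "\<lambda>i. of_bool (i = a)"] form[of "\<lambda>i. of_bool (i = a)"] show ?thesis by simp
  qed
  \<comment> \<open>A zero pivot forces a zero row: otherwise the form at the vector with entry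
    \<open>t\<close> at \<open>a\<close> and entry 1 at \<open>j\<close> is linear in
    \<open>t\<close> with nonzero slope, and the chosen \<open>t\<close> gives it the value
    -1.\<close>
  have za: "Z a j = 0" if "Z a a = 0" "j \<in> W" for j
  proof (rule ccontr)
    assume nz: "Z a j \<noteq> 0"
    define t where "t = - (1 + Z j j) / (2 * Z a j)"
    define v where "v = (\<lambda>i. if i = a then t else of_bool (i = j))"
    have "(\<Sum>i\<in>W. \<Sum>l\<in>W. v i * Z i l * v l) = (\<Sum>i\<in>W. \<Sum>l\<in>W. if l = j then if i = j then Z j j else 0 else 0)"
      using insert.hyps that by (intro sum.cong) (auto simp: v_def)
    also have "\<dots> = Z j j" using insert.hyps that by simp
    finally have 1: "(\<Sum>i\<in>W. \<Sum>l\<in>W. v i * Z i l * v l) = Z j j" .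
    have "(\<Sum>l\<in>W. Z a l * v l) = (\<Sum>l\<in>W. if l = j then Z a j else 0)"
      using insert.hyps that by (intro sum.cong) (auto simp: v_def)
    also have "\<dots> = Z a j" using insert.hyps that by simp
    finally have 2: "(\<Sum>l\<in>W. Z a l * v l) = Z a j" .
    have "0 \<le> 2 * t * Z a j + Z j j"
      using psd[of v] form[of v] 1 2 that by (simp add: v_def)
    also have "\<dots> = -1" using nz by (simp add: t_def field_simps)
    finally show False by simp
  qed
  \<comment> \<open>The Schur complement; as \<open>x / 0 = 0\<close>, it is \<open>Z\<close> itself
    when the pivot vanishes.\<close>
  define Y where "Y = (\<lambda>i j. Z i j - Z a i * Z a j / Z a a)"
  have "0 \<le> (\<Sum>i\<in>W. \<Sum>j\<in>W. v i * Y i j * v j)" for v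
  proof -
    define s where "s = (\<Sum>j\<in>W. Z a j * v j)"
    \<comment> \<open>For a positive pivot, this entry at \<open>a\<close> minimises the form of
      \<open>Z\<close> over that coordinate, and the minimum is the form of \<open>Y\<close> at
      \<open>v\<close>.\<close>
    define v' where "v' = v(a := - s / Z a a)"
    have s': "(\<Sum>j\<in>W. Z a j * v' j) = s" "(\<Sum>i\<in>W. \<Sum>j\<in>W. v' i * Z i j * v' j) = (\<Sum>i\<in>W. \<Sum>j\<in>W. v i * Z i j * v j)"
      using insert.hyps unfolding s_def v'_def by (auto intro!: sum.cong)
    have "(\<Sum>i\<in>W. \<Sum>j\<in>W. v i * Y i j * v j) =
        (\<Sum>i\<in>W. \<Sum>j\<in>W. v i * Z i j * v j) - (\<Sum>i\<in>W. \<Sum>j\<in>W. (Z a i * v i) * (Z a j * v j)) / Z a a"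
      by (simp add: Y_def sum_subtractf sum_divide_distrib algebra_simps)
    also have "(\<Sum>i\<in>W. \<Sum>j\<in>W. (Z a i * v i) * (Z a j * v j)) = s * s"
      by (simp add: s_def sum_product)
    also have "(\<Sum>i\<in>W. \<Sum>j\<in>W. v i * Z i j * v j) - s * s / Z a a =
        (\<Sum>i\<in>insert a W. \<Sum>j\<in>insert a W. v' i * Z i j * v' j)"
      unfolding form s' by (cases "Z a a = 0") (simp_all add: v'_def power2_eq_square field_simps)
    finally show ?thesis using psd[of v'] by simp
  qed
  moreover have "Y i j = Y j i" if "i \<in> W" "j \<in> W" for i j
    using sym[of i j] that by (simp add: Y_def)
  ultimately obtain q where q: "\<And>i j. i \<in> W \<Longrightarrow> j \<in> W \<Longrightarrow> Y i j = (\<Sum>m\<in>W. q m i * q m j)"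
    using insert.IH[of Y] by blast
  define q' where "q' = (\<lambda>m i. if m = a then Z a i / sqrt (Z a a) else if i = a then 0 else q m i)"
  have "Z i j = (\<Sum>m\<in>insert a W. q' m i * q' m j)" if ij: "i \<in> insert a W" "j \<in> insert a W" for i j
  proof -
    have "q' a i * q' a j = Z a i * Z a j / Z a a"
      using aa by (simp add: q'_def)
    moreover have "(\<Sum>m\<in>W. q' m i * q' m j) = (if i = a \<or> j = a then 0 else \<Sum>m\<in>W. q m i * q m j)"
      using insert.hyps by (auto intro!: sum.neutral sum.cong simp: q'_def)
    ultimately have "(\<Sum>m\<in>insert a W. q' m i * q' m j) =
        Z a i * Z a j / Z a a + (if i = a \<or> j = a then 0 else Y i j)"
      using insert.hyps q[of i j] ij by auto
    also have "\<dots> = Z i j"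
      using ij za sym[of i j] by (cases "Z a a = 0") (auto simp: Y_def)
    finally show ?thesis by simp
  qed
  then show ?case by blast
qed

text \<open>A Gram factorisation of \<open>Z\<close> turns the pairing into a sum of values of the
  form of \<open>Q\<close>, one for each vector \<open>q m\<close>.\<close>

lemma trace_psd_nonneg:
  fixes Z Q :: "'a \<Rightarrow> 'a \<Rightarrow> real"
  assumes "finite W"
    and "\<And>i j. i \<in> W \<Longrightarrow> j \<in> W \<Longrightarrow> Z i j = Z j i"
    and "\<And>v. 0 \<le> (\<Sum>i\<in>W. \<Sum>j\<in>W. v i * Z i j * v j)"
    and Q: "\<And>v. 0 \<le> (\<Sum>i\<in>W. \<Sum>j\<in>W. v i * Q i j * v j)"
  shows "0 \<le> (\<Sum>i\<in>W. \<Sum>j\<in>W. Q i j * Z i j)"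
proof -
  obtain q where q: "\<And>i j. i \<in> W \<Longrightarrow> j \<in> W \<Longrightarrow> Z i j = (\<Sum>m\<in>W. q m i * q m j)"
    using psd_gram[OF assms(1-3)] by blast
  have "(\<Sum>i\<in>W. \<Sum>j\<in>W. Q i j * Z i j) = (\<Sum>i\<in>W. \<Sum>j\<in>W. \<Sum>m\<in>W. q m i * Q i j * q m j)"
    by (intro sum.cong refl) (simp add: q sum_distrib_left algebra_simps)
  also have "\<dots> = (\<Sum>i\<in>W. \<Sum>m\<in>W. \<Sum>j\<in>W. q m i * Q i j * q m j)"
    by (intro sum.cong refl sum.swap)
  also have "\<dots> = (\<Sum>m\<in>W. \<Sum>i\<in>W. \<Sum>j\<in>W. q m i * Q i j * q m j)"
    by (rule sum.swap)
  finally show ?thesis using Q by (simp add: sum_nonneg)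
qed

section \<open>Partitions and their feasible matrices\<close>

definition cluster :: "nat set set \<Rightarrow> nat \<Rightarrow> nat set" where
  "cluster \<Gamma> i = (THE S. S \<in> \<Gamma> \<and> i \<in> S)"

lemma cluster_eq:
  assumes "is_partition W k \<Gamma>" "S \<in> \<Gamma>" "i \<in> S"
  shows "cluster \<Gamma> i = S"
  unfolding cluster_def by (rule the_equality) (use assms in \<open>auto simp: is_partition_def\<close>)

lemma cluster_in:
  assumes "is_partition W k \<Gamma>" "i \<in> W"
  shows "cluster \<Gamma> i \<in> \<Gamma>" "i \<in> cluster \<Gamma> i"
proof -
  obtain S where "S \<in> \<Gamma>" "i \<in> S" using assms by (auto simp: is_partition_def)
  then show "cluster \<Gamma> i \<in> \<Gamma>" "i \<in> cluster \<Gamma> i"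
    using cluster_eq[OF assms(1)] by auto
qed

lemma partition_subset:
  assumes "is_partition W k \<Gamma>" "S \<in> \<Gamma>"
  shows "S \<subseteq> W"
  using assms by (auto simp: is_partition_def)

lemma partition_finite:
  assumes "is_partition W k \<Gamma>" "finite W"
  shows "finite \<Gamma>" "S \<in> \<Gamma> \<Longrightarrow> finite S" "S \<in> \<Gamma> \<Longrightarrow> 0 < card S"
proof -
  show "finite \<Gamma>" using assms by (auto simp: is_partition_def intro: finite_UnionD)
  show S: "finite S" if "S \<in> \<Gamma>" for S
    using assms that by (auto simp: is_partition_def intro: finite_subset)
  show "0 < card S" if "S \<in> \<Gamma>" for S
    using assms(1) S[OF that] that by (auto simp: is_partition_def card_gt_0_iff)
qed

lemma sum_partition:
  assumes "is_partition W k \<Gamma>" "finite W"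
  shows "(\<Sum>i\<in>W. f i) = (\<Sum>S\<in>\<Gamma>. \<Sum>i\<in>S. f i)"
proof -
  have "W = \<Union>\<Gamma>" using assms by (simp add: is_partition_def)
  moreover have "sum f (\<Union>\<Gamma>) = (\<Sum>S\<in>\<Gamma>. sum f S)"
    using assms partition_finite[OF assms]
    by (subst sum.Union_disjoint) (auto simp: is_partition_def)
  ultimately show ?thesis by simp
qed

lemma sum_sum_partition:
  fixes f :: "nat \<Rightarrow> nat \<Rightarrow> real"
  assumes "is_partition W k \<Gamma>" "finite W"
  shows "(\<Sum>i\<in>W. \<Sum>j\<in>W. f i j) = (\<Sum>S\<in>\<Gamma>. \<Sum>T\<in>\<Gamma>. \<Sum>i\<in>S. \<Sum>j\<in>T. f i j)"
proof -
  have "(\<Sum>i\<in>W. \<Sum>j\<in>W. f i j) = (\<Sum>S\<in>\<Gamma>. \<Sum>i\<in>S. \<Sum>T\<in>\<Gamma>. \<Sum>j\<in>T. f i j)"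
    by (simp add: sum_partition[OF assms])
  also have "\<dots> = (\<Sum>S\<in>\<Gamma>. \<Sum>T\<in>\<Gamma>. \<Sum>i\<in>S. \<Sum>j\<in>T. f i j)"
    by (intro sum.cong refl sum.swap)
  finally show ?thesis .
qed

lemma Zmat_cluster:
  assumes "is_partition W k \<Gamma>" "finite W" "i \<in> W" "j \<in> W"
  shows "Zmat \<Gamma> i j = (if cluster \<Gamma> i = cluster \<Gamma> j then 1 / real (card (cluster \<Gamma> i)) else 0)"
proof -
  have "Zmat \<Gamma> i j = (\<Sum>S\<in>\<Gamma>. if S = cluster \<Gamma> i then
      (if cluster \<Gamma> i = cluster \<Gamma> j then 1 / real (card (cluster \<Gamma> i)) else 0) else 0)"
    unfolding Zmat_def
  proof (rule sum.cong[OF refl])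
    fix S assume S: "S \<in> \<Gamma>"
    have "i \<in> S \<longleftrightarrow> S = cluster \<Gamma> i" "j \<in> S \<longleftrightarrow> S = cluster \<Gamma> j"
      using cluster_eq[OF assms(1) S] cluster_in[OF assms(1)] assms(3,4) by auto
    then show "(if i \<in> S \<and> j \<in> S then 1 / real (card S) else 0) = (if S = cluster \<Gamma> i then
      (if cluster \<Gamma> i = cluster \<Gamma> j then 1 / real (card (cluster \<Gamma> i)) else 0) else 0)" by auto
  qed
  also have "\<dots> = (if cluster \<Gamma> i = cluster \<Gamma> j then 1 / real (card (cluster \<Gamma> i)) else 0)"
    using partition_finite(1)[OF assms(1,2)] cluster_in(1)[OF assms(1,3)] by simp
  finally show ?thesis .
qed

lemma Zmat_outside:
  assumes "is_partition W k \<Gamma>" "i \<notin> W \<or> j \<notin> W"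
  shows "Zmat \<Gamma> i j = 0"
proof -
  show ?thesis unfolding Zmat_def using partition_subset[OF assms(1)] assms(2) by (intro sum.neutral ballI) auto
qed

lemma Zmat_blocks:
  assumes "is_partition W k \<Gamma>" "finite W" "S \<in> \<Gamma>" "T \<in> \<Gamma>" "i \<in> S" "j \<in> T"
  shows "Zmat \<Gamma> i j = (if S = T then 1 / real (card S) else 0)"
proof -
  have "i \<in> W" "j \<in> W" using assms by (auto simp: is_partition_def)
  then show ?thesis
    using Zmat_cluster[OF assms(1,2)] cluster_eq[OF assms(1,3,5)] cluster_eq[OF assms(1,4,6)] by simp
qed

lemma sum_Zmat_form:
  fixes f :: "nat \<Rightarrow> nat \<Rightarrow> real"
  assumes "is_partition W k \<Gamma>" "finite W"
  shows "(\<Sum>i\<in>W. \<Sum>j\<in>W. f i j * Zmat \<Gamma> i j) = (\<Sum>S\<in>\<Gamma>. (\<Sum>i\<in>S. \<Sum>j\<in>S. f i j) / real (card S))"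
proof -
  have "(\<Sum>i\<in>W. \<Sum>j\<in>W. f i j * Zmat \<Gamma> i j) =
      (\<Sum>S\<in>\<Gamma>. \<Sum>T\<in>\<Gamma>. \<Sum>i\<in>S. \<Sum>j\<in>T. f i j * (if S = T then 1 / real (card S) else 0))"
    unfolding sum_sum_partition[OF assms]
    by (intro sum.cong refl arg_cong2[of _ _ _ _ "(*)"] Zmat_blocks[OF assms]) auto
  also have "\<dots> = (\<Sum>S\<in>\<Gamma>. \<Sum>T\<in>\<Gamma>. if T = S then (\<Sum>i\<in>S. \<Sum>j\<in>S. f i j) / real (card S) else 0)"
    by (intro sum.cong refl) (auto simp: sum_divide_distrib)
  also have "\<dots> = (\<Sum>S\<in>\<Gamma>. (\<Sum>i\<in>S. \<Sum>j\<in>S. f i j) / real (card S))"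
    using partition_finite(1)[OF assms] by simp
  finally show ?thesis .
qed

lemma Zmat_feasible:
  assumes "is_partition W k \<Gamma>" "finite W"
  shows "pw_feasible W k (Zmat \<Gamma>)"
  unfolding pw_feasible_def
proof (intro conjI allI ballI impI)
  fix i j
  show "Zmat \<Gamma> i j = 0" if "i \<notin> W \<or> j \<notin> W" using Zmat_outside[OF assms(1) that] .
  show "Zmat \<Gamma> i j = Zmat \<Gamma> j i" by (simp add: Zmat_def conj_commute)
  show "0 \<le> Zmat \<Gamma> i j" by (auto simp: Zmat_def intro!: sum_nonneg)
next
  fix i assume i: "i \<in> W"
  let ?S = "cluster \<Gamma> i"
  note S = cluster_in[OF assms(1) i]
  have "(\<Sum>j\<in>W. Zmat \<Gamma> i j) = (\<Sum>T\<in>\<Gamma>. \<Sum>j\<in>T. if ?S = T then 1 / real (card ?S) else 0)"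
    unfolding sum_partition[OF assms] by (intro sum.cong refl Zmat_blocks[OF assms S(1) _ S(2)])
  also have "\<dots> = (\<Sum>T\<in>\<Gamma>. if ?S = T then 1 else 0)"
    using partition_finite(3)[OF assms S(1)] by (intro sum.cong) auto
  also have "\<dots> = 1" using S partition_finite(1)[OF assms] by simp
  finally show "(\<Sum>j\<in>W. Zmat \<Gamma> i j) = 1" .
next
  have "(\<Sum>i\<in>W. Zmat \<Gamma> i i) = (\<Sum>T\<in>\<Gamma>. \<Sum>j\<in>T. 1 / real (card T))"
    unfolding sum_partition[OF assms] by (intro sum.cong refl) (simp add: Zmat_blocks[OF assms])
  also have "\<dots> = (\<Sum>T\<in>\<Gamma>. 1)"
    using partition_finite(3)[OF assms] by (intro sum.cong) auto
  also have "\<dots> = real k" using assms by (simp add: is_partition_def)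
  finally show "(\<Sum>i\<in>W. Zmat \<Gamma> i i) = real k" .
next
  fix v :: "nat \<Rightarrow> real"
  have "(\<Sum>i\<in>W. \<Sum>j\<in>W. v i * Zmat \<Gamma> i j * v j) = (\<Sum>i\<in>W. \<Sum>j\<in>W. (v i * v j) * Zmat \<Gamma> i j)"
    by (simp add: algebra_simps)
  also have "\<dots> = (\<Sum>S\<in>\<Gamma>. (\<Sum>i\<in>S. v i) * (\<Sum>i\<in>S. v i) / real (card S))"
    unfolding sum_Zmat_form[OF assms] by (simp add: sum_product)
  also have "\<dots> \<ge> 0" by (intro sum_nonneg) auto
  finally show "0 \<le> (\<Sum>i\<in>W. \<Sum>j\<in>W. v i * Zmat \<Gamma> i j * v j)" .
qed

text \<open>A block diagonal feasible matrix fixes every \<open>1\<^sub>S\<close>, so \<open>Z - Zmat \<Gamma>\<close> is positive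
  semidefinite; as it has trace 0, it vanishes.\<close>
lemma feasible_block_diagonal_eq_Zmat:
  assumes P: "is_partition W k \<Gamma>" "finite W" and Z: "pw_feasible W k Z"
    and off: "\<And>S T i j. S \<in> \<Gamma> \<Longrightarrow> T \<in> \<Gamma> \<Longrightarrow> S \<noteq> T \<Longrightarrow> i \<in> S \<Longrightarrow> j \<in> T \<Longrightarrow> Z i j = 0"
  shows "Z = Zmat \<Gamma>"
proof -
  let ?Y = "\<lambda>i j. Z i j - Zmat \<Gamma> i j"
  note F = Z[unfolded pw_feasible_def] and G = Zmat_feasible[OF P, unfolded pw_feasible_def]
  have Zsym: "Z i j = Z j i" if "i \<in> W" "j \<in> W" for i j using F that by blast
  have blockrow: "(\<Sum>j\<in>S. Z i j) = 1" if "S \<in> \<Gamma>" "i \<in> S" for S i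
  proof -
    have "i \<in> W" using that P by (auto simp: is_partition_def)
    then have "(\<Sum>j\<in>W. Z i j) = 1" using F by blast
    then have "1 = (\<Sum>T\<in>\<Gamma>. \<Sum>j\<in>T. Z i j)" using sum_partition[OF P, of "Z i"] by simp
    also have "\<dots> = (\<Sum>T\<in>\<Gamma>. if T = S then \<Sum>j\<in>S. Z i j else 0)"
      using that by (intro sum.cong) (auto simp del: disjoint_iff simp: off[OF that(1) _ _ that(2)] intro!: sum.neutral)
    also have "\<dots> = (\<Sum>j\<in>S. Z i j)" using partition_finite(1)[OF P] that by simp
    finally show ?thesis by simp
  qed
  have form: "(\<Sum>i\<in>W. \<Sum>j\<in>W. v i * Z i j * v j) = (\<Sum>S\<in>\<Gamma>. \<Sum>i\<in>S. \<Sum>j\<in>S. v i * Z i j * v j)" for v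
  proof -
    have "(\<Sum>i\<in>W. \<Sum>j\<in>W. v i * Z i j * v j) =
        (\<Sum>S\<in>\<Gamma>. \<Sum>T\<in>\<Gamma>. if T = S then \<Sum>i\<in>S. \<Sum>j\<in>S. v i * Z i j * v j else 0)"
      unfolding sum_sum_partition[OF P]
      by (intro sum.cong refl) (auto intro!: sum.neutral simp: off)
    then show ?thesis using partition_finite(1)[OF P] by simp
  qed
  have psdZ: "0 \<le> (\<Sum>i\<in>W. \<Sum>j\<in>W. v i * Z i j * v j)" for v
    using F by blast
  have psd: "0 \<le> (\<Sum>i\<in>W. \<Sum>j\<in>W. v i * ?Y i j * v j)" for v
  proof -
    \<comment> \<open>Since \<open>Z\<close> fixes each \<open>1\<^sub>S\<close>, the form of
      \<open>Z - Zmat \<Gamma>\<close> at \<open>v\<close> equals the form of \<open>Z\<close> at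
      \<open>w\<close>, that is, at \<open>v\<close> with its cluster means removed.\<close>
    define m where "m S = (\<Sum>i\<in>S. v i) / real (card S)" for S
    define w where "w = (\<lambda>i. v i - m (cluster \<Gamma> i))"
    have "(\<Sum>i\<in>S. \<Sum>j\<in>S. w i * Z i j * w j) =
        (\<Sum>i\<in>S. \<Sum>j\<in>S. v i * Z i j * v j) - (\<Sum>i\<in>S. \<Sum>j\<in>S. v i * v j) / real (card S)"
      if S: "S \<in> \<Gamma>" for S
    proof -
      have SW: "S \<subseteq> W" using S P by (auto simp: is_partition_def)
      have col: "(\<Sum>i\<in>S. Z i j) = 1" if "j \<in> S" for j
      proof -
        have "(\<Sum>i\<in>S. Z i j) = (\<Sum>i\<in>S. Z j i)"
          by (rule sum.cong) (use Zsym that SW in auto)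
        then show ?thesis using blockrow[OF S that] by simp
      qed
      have c: "real (card S) > 0" using partition_finite(3)[OF P S] by simp
      have "(\<Sum>i\<in>S. \<Sum>j\<in>S. w i * Z i j * w j) = (\<Sum>i\<in>S. \<Sum>j\<in>S. (v i - m S) * Z i j * (v j - m S))"
        by (intro sum.cong refl) (simp add: w_def cluster_eq[OF P(1) S])
      also have "\<dots> = (\<Sum>i\<in>S. \<Sum>j\<in>S. v i * Z i j * v j) - m S * (\<Sum>i\<in>S. \<Sum>j\<in>S. v i * Z i j)
          - m S * (\<Sum>i\<in>S. \<Sum>j\<in>S. v j * Z i j) + m S * m S * (\<Sum>i\<in>S. \<Sum>j\<in>S. Z i j)"
        by (simp add: algebra_simps sum.distrib sum_subtractf sum_distrib_left)
      also have "(\<Sum>i\<in>S. \<Sum>j\<in>S. v i * Z i j) = (\<Sum>i\<in>S. v i)"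
        by (simp add: sum_distrib_left[symmetric] blockrow[OF S])
      also have "(\<Sum>i\<in>S. \<Sum>j\<in>S. v j * Z i j) = (\<Sum>j\<in>S. v j)"
        by (subst sum.swap) (simp add: sum_distrib_left[symmetric] col)
      also have "(\<Sum>i\<in>S. \<Sum>j\<in>S. Z i j) = real (card S)"
        by (simp add: blockrow[OF S])
      also have "(\<Sum>i\<in>S. v i) = m S * card S" using c by (simp add: m_def)
      also have "(\<Sum>i\<in>S. \<Sum>j\<in>S. v i * Z i j * v j) - m S * (m S * card S) - m S * (m S * card S)
           + m S * m S * card S = (\<Sum>i\<in>S. \<Sum>j\<in>S. v i * Z i j * v j) - (m S * card S) * (m S * card S) / card S"
        using c by simp
      also have "m S * card S = (\<Sum>i\<in>S. v i)" using c by (simp add: m_def)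
      finally show ?thesis by (simp add: sum_product)
    qed
    then have "(\<Sum>i\<in>W. \<Sum>j\<in>W. w i * Z i j * w j) =
        (\<Sum>i\<in>W. \<Sum>j\<in>W. v i * Z i j * v j) - (\<Sum>i\<in>W. \<Sum>j\<in>W. (v i * v j) * Zmat \<Gamma> i j)"
      unfolding form sum_Zmat_form[OF P] by (simp add: sum_subtractf)
    also have "\<dots> = (\<Sum>i\<in>W. \<Sum>j\<in>W. v i * ?Y i j * v j)"
      by (simp add: algebra_simps sum_subtractf)
    finally show ?thesis using psdZ[of w] by simp
  qed
  have sym: "?Y i j = ?Y j i" if "i \<in> W" "j \<in> W" for i j using F G that by simp
  obtain q where q: "\<And>i j. i \<in> W \<Longrightarrow> j \<in> W \<Longrightarrow> ?Y i j = (\<Sum>m\<in>W. q m i * q m j)"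
    using psd_gram[of W ?Y, OF P(2) sym psd] by blast
  \<comment> \<open>The trace of a Gram matrix is the sum of the squares of all entries of its
    vectors; here it is 0 because both matrices have trace \<open>k\<close>.\<close>
  have "(\<Sum>i\<in>W. \<Sum>m\<in>W. (q m i)\<^sup>2) = (\<Sum>i\<in>W. ?Y i i)"
    by (intro sum.cong refl) (simp add: q power2_eq_square)
  also have "\<dots> = 0" using F G by (simp add: sum_subtractf)
  finally have "q m i = 0" if "m \<in> W" "i \<in> W" for m i
    using P(2) that by (simp add: sum_nonneg_eq_0_iff sum_nonneg)
  then have "?Y i j = 0" if "i \<in> W" "j \<in> W" for i j using q that by simp
  moreover have "?Y i j = 0" if "i \<notin> W \<or> j \<notin> W" for i j using F G that by simp
  ultimately have "Z i j = Zmat \<Gamma> i j" for i j by (metis eq_iff_diff_eq_0)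
  then show ?thesis by blast
qed

lemma sum_centered:
  assumes "finite S" "S \<noteq> {}"
  shows "(\<Sum>i\<in>S. X i l - centroid X S l) = 0"
  using assms by (simp add: centroid_def sum_subtractf)

section \<open>The dual certificate\<close>

text \<open>The form \<open>\<langle>a, H b\<rangle>\<close> of the reflection \<open>H\<close> in the hyperplane orthogonal to \<open>c\<close>; as
  \<open>x / 0 = 0\<close>, \<open>H\<close> is the identity for \<open>c = 0\<close>, which is the case needed on diagonal blocks.\<close>
definition reflect_form :: "nat \<Rightarrow> (nat \<Rightarrow> real) \<Rightarrow> (nat \<Rightarrow> real) \<Rightarrow> (nat \<Rightarrow> real) \<Rightarrow> real" where
  "reflect_form d c a b = vinner d a b - 2 * vinner d a c * vinner d b c / vinner d c c"

text \<open>The reflected vector \<open>?b\<close> has the same norm as \<open>b\<close>, so this is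
  the Cauchy-Schwarz inequality for \<open>a\<close> and \<open>?b\<close>.\<close>

lemma reflect_form_le: "reflect_form d c a b \<le> vnorm d a * vnorm d b"
proof -
  let ?s = "2 * vinner d b c / vinner d c c"
  let ?b = "\<lambda>l. b l - ?s * c l"
  have "vinner d ?b ?b = vinner d b b - 2 * ?s * vinner d b c + ?s * (?s * vinner d c c)"
    unfolding vinner_diff_left vinner_diff_right vinner_scale_left vinner_scale_right
    by (simp add: vinner_commute[of d c b])
  also have "\<dots> = vinner d b b" by (cases "vinner d c c = 0") simp_all
  finally have "vinner d ?b ?b = vinner d b b" .
  then have "vnorm d ?b = vnorm d b" by (simp add: vnorm_def)
  moreover have "reflect_form d c a b = vinner d a ?b"
    by (simp add: reflect_form_def vinner_linear)
  ultimately show ?thesis using vinner_le_vnorm[of d a ?b] by simp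
qed

text \<open>Bilinearity; it reduces each block of the quadratic form of \<open>Q\<close> to the two
  vectors obtained by combining the points of a cluster.\<close>

lemma reflect_form_sum:
  "(\<Sum>i\<in>S. \<Sum>j\<in>T. q i * reflect_form d c (u i) (u j) * q j) =
    reflect_form d c (\<lambda>l. \<Sum>i\<in>S. q i * u i l) (\<lambda>l. \<Sum>i\<in>T. q i * u i l)"
proof -
  have "vinner d (\<lambda>l. \<Sum>i\<in>S. q i * u i l) (\<lambda>l. \<Sum>i\<in>T. q i * u i l) =
      (\<Sum>i\<in>S. \<Sum>j\<in>T. q i * vinner d (u i) (u j) * q j)"
    unfolding vinner_sum_left vinner_sum_right by (simp add: sum_distrib_left algebra_simps)
  moreover have "2 * (\<Sum>i\<in>S. q i * vinner d (u i) c) * (\<Sum>i\<in>T. q i * vinner d (u i) c) / vinner d c c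
     = (\<Sum>i\<in>S. \<Sum>j\<in>T. q i * (2 * vinner d (u i) c * vinner d (u j) c / vinner d c c) * q j)"
    by (simp add: sum_distrib_left sum_distrib_right sum_divide_distrib sum_product algebra_simps)
  ultimately show ?thesis
    unfolding reflect_form_def vinner_sum_left by (simp add: algebra_simps sum_subtractf)
qed

text \<open>A matrix and its transpose have the same spectral norm: the hypothesis is tested at
  \<open>y = ?a\<close>, the combination itself, and one factor \<open>?n\<close> is
  cancelled.\<close>

lemma vnorm_combination_le:
  assumes K0: "0 \<le> K" and K: "\<And>y. (\<Sum>i\<in>S. (vinner d y (u i))\<^sup>2) \<le> K * vinner d y y"
  shows "(vnorm d (\<lambda>l. \<Sum>i\<in>S. w i * u i l))\<^sup>2 \<le> K * (\<Sum>i\<in>S. (w i)\<^sup>2)"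
proof -
  let ?a = "\<lambda>l. \<Sum>i\<in>S. w i * u i l"
  let ?n = "vinner d ?a ?a" and ?w = "\<Sum>i\<in>S. (w i)\<^sup>2"
  have n: "0 \<le> ?n" by (rule vinner_self_nonneg)
  have w: "0 \<le> ?w" by (simp add: sum_nonneg)
  have "?n\<^sup>2 = (\<Sum>i\<in>S. w i * vinner d ?a (u i))\<^sup>2"
    by (simp add: vinner_sum_right)
  also have "\<dots> \<le> ?w * (\<Sum>i\<in>S. (vinner d ?a (u i))\<^sup>2)"
    by (rule Cauchy_Schwarz_ineq_sum)
  also have "\<dots> \<le> ?w * (K * ?n)" by (rule mult_left_mono[OF K w])
  finally have *: "?n * ?n \<le> (K * ?w) * ?n" by (simp add: power2_eq_square algebra_simps)
  show ?thesis
  proof (cases "?n = 0")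
    case False
    then show ?thesis using * n by (simp add: vnorm_squared)
  next
    case True
    then show ?thesis using w K0 by (simp add: vnorm_squared)
  qed
qed

text \<open>The variance identity; the right-hand side is the form of the identity minus
  \<open>Z\<^sub>\<Gamma>\<close> on one diagonal block.\<close>

lemma sum_square_deviation:
  fixes q :: "'a \<Rightarrow> real"
  assumes "finite S" "S \<noteq> {}"
  defines "m \<equiv> (\<Sum>i\<in>S. q i) / real (card S)"
  shows "(\<Sum>i\<in>S. (q i - m)\<^sup>2) = (\<Sum>i\<in>S. (q i)\<^sup>2) - (\<Sum>i\<in>S. \<Sum>j\<in>S. q i * q j) / real (card S)"
proof -
  have c: "real (card S) > 0" using assms by (simp add: card_gt_0_iff)
  then have s: "(\<Sum>i\<in>S. q i) = m * card S" by (simp add: m_def)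
  have "(\<Sum>i\<in>S. (q i - m)\<^sup>2) = (\<Sum>i\<in>S. (q i)\<^sup>2) - 2 * m * (\<Sum>i\<in>S. q i) + card S * m\<^sup>2"
    by (simp add: power2_diff sum.distrib sum_subtractf sum_distrib_left sum_distrib_right mult_ac)
  also have "\<dots> = (\<Sum>i\<in>S. (q i)\<^sup>2) - (\<Sum>i\<in>S. q i) * (\<Sum>i\<in>S. q i) / card S"
    unfolding s using c by (simp add: power2_eq_square field_simps)
  finally show ?thesis by (simp add: sum_product)
qed

text \<open>\<open>K S\<close> has to dominate the covariance form of the cluster without being its
  squared spectral norm, so that a sampled cluster can inherit a bound from the full one. Strictness
  of the separation is what yields uniqueness.\<close>

theorem peng_wei_unique_minimizer:
  assumes P: "is_partition W k \<Gamma>" "finite W"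
    and K0: "\<And>S. S \<in> \<Gamma> \<Longrightarrow> 0 \<le> K S"
    and K: "\<And>S y. S \<in> \<Gamma> \<Longrightarrow>
      (\<Sum>i\<in>S. (vinner d y (\<lambda>l. X i l - centroid X S l))\<^sup>2) \<le> K S * vinner d y y"
    and sep: "\<And>S T i. S \<in> \<Gamma> \<Longrightarrow> T \<in> \<Gamma> \<Longrightarrow> S \<noteq> T \<Longrightarrow> i \<in> S \<Longrightarrow>
      1/2 * sqrt ((1 / real (card S) + 1 / real (card T)) * (\<Sum>R\<in>\<Gamma>. K R)) <
      vinner d (\<lambda>l. X i l - (centroid X S l + centroid X T l) / 2)
        (\<lambda>l. (centroid X S l - centroid X T l) / vnorm d (\<lambda>l. centroid X S l - centroid X T l))"
  shows "pw_unique_minimizer d X W k (Zmat \<Gamma>)"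
proof -
  define cl where "cl = cluster \<Gamma>"
  note cl_eq = cluster_eq[OF P(1), folded cl_def] and cl_in = cluster_in[OF P(1), folded cl_def]
  note finS = partition_finite(2)[OF P] and cardS = partition_finite(3)[OF P]
  define z where "z = 2 * (\<Sum>R\<in>\<Gamma>. K R)"
  define u where "u i = (\<lambda>l. X i l - centroid X (cl i) l)" for i
  define c where "c S T = (\<lambda>l. centroid X S l - centroid X T l)" for S T
  define Q where "Q i j = z * ((if i = j then 1 else 0) - Zmat \<Gamma> i j)
      - 2 * reflect_form d (c (cl i) (cl j)) (u i) (u j)" for i j
  define lam where "lam i = vinner d (u i) (u i) + z / (2 * real (card (cl i)))" for i
  \<comment> \<open>On feasible matrices, pairing with \<open>L\<close> and pairing with
    \<open>sqdist\<close> differ by a constant, because rows and columns sum to 1 and the trace is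
    \<open>k\<close>. The choice of \<open>lam\<close> makes \<open>L\<close> and \<open>Q\<close>
    agree on diagonal blocks.\<close>
  define L where "L i j = sqdist d X i j - lam i - lam j + (if i = j then z else 0)" for i j

  have u_eq: "u i = (\<lambda>l. X i l - centroid X S l)" if "S \<in> \<Gamma>" "i \<in> S" for S i
    using cl_eq[OF that] by (simp add: u_def)
  have usum: "(\<Sum>i\<in>S. u i l) = 0" if "S \<in> \<Gamma>" for S l
  proof -
    have "(\<Sum>i\<in>S. u i l) = (\<Sum>i\<in>S. X i l - centroid X S l)"
      by (intro sum.cong refl) (simp add: u_eq[OF that])
    moreover have "S \<noteq> {}" using cardS[OF that] by auto
    ultimately show ?thesis using sum_centered[OF finS[OF that], of X l] by simp
  qed
  have Ku: "(\<Sum>i\<in>S. (vinner d y (u i))\<^sup>2) \<le> K S * vinner d y y" if "S \<in> \<Gamma>" for S y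
    using K[OF that, of y] by (simp add: u_eq[OF that] cong: sum.cong)
  have sqd: "sqdist d X i j = vinner d (u i) (u i) + vinner d (u j) (u j) + vinner d (c (cl i) (cl j)) (c (cl i) (cl j))
      - 2 * vinner d (u i) (u j) + 2 * vinner d (u i) (c (cl i) (cl j)) - 2 * vinner d (u j) (c (cl i) (cl j))" for i j
  proof -
    let ?c = "c (cl i) (cl j)"
    have "(\<lambda>l. X i l - X j l) = (\<lambda>l. (u i l - u j l) + ?c l)" by (auto simp: u_def c_def)
    then have "sqdist d X i j = vinner d (\<lambda>l. (u i l - u j l) + ?c l) (\<lambda>l. (u i l - u j l) + ?c l)"
      by (simp add: sqdist_def vnorm_squared)
    then show ?thesis
      by (simp add: vinner_linear vinner_commute[of d "u j" "u i"] vinner_commute[of d ?c "u i"] vinner_commute[of d ?c "u j"])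
  qed
  have same: "L i j = Q i j" if "S \<in> \<Gamma>" "i \<in> S" "j \<in> S" for S i j
  proof -
    have "c (cl i) (cl j) = (\<lambda>l. 0)" using that cl_eq by (auto simp: c_def)
    then show ?thesis using that
      by (simp add: L_def Q_def lam_def sqd reflect_form_def cl_eq[OF that(1)] Zmat_blocks[OF P that(1,1)]
          vinner_def right_diff_distrib)
  qed
  have diff: "Q i j < L i j" if ST: "S \<in> \<Gamma>" "T \<in> \<Gamma>" "S \<noteq> T" "i \<in> S" "j \<in> T" for S T i j
  proof -
    let ?c = "c S T"
    define N where "N = vnorm d ?c"
    define s where "s = vinner d (u i) ?c"
    define t where "t = vinner d (u j) ?c"
    define b where "b = 1/2 * sqrt ((1 / real (card S) + 1 / real (card T)) * (\<Sum>R\<in>\<Gamma>. K R))"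
    have pos: "0 \<le> (1 / real (card S) + 1 / real (card T)) * (\<Sum>R\<in>\<Gamma>. K R)"
      by (intro mult_nonneg_nonneg sum_nonneg K0) auto
    then have b0: "0 \<le> b" by (simp add: b_def)
    \<comment> \<open>The right-hand side is what the terms with \<open>z\<close> in
      \<open>lam i\<close> and \<open>lam j\<close> add up to, so \<open>b\<close> is exactly the
      threshold at which \<open>L\<close> exceeds \<open>Q\<close>.\<close>
    have bsq: "4 * (b * b) = (1 / real (card S) + 1 / real (card T)) * z / 2"
      using pos by (simp add: b_def z_def)
    have NN: "vinner d ?c ?c = N * N" using vnorm_squared[of d ?c] by (simp add: N_def power2_eq_square)
    have "(\<lambda>l. X i l - (centroid X S l + centroid X T l) / 2) = (\<lambda>l. u i l + ?c l / 2)"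
      by (auto simp: u_eq[OF ST(1,4)] c_def field_simps)
    then have "b < vinner d (\<lambda>l. u i l + ?c l / 2) (\<lambda>l. ?c l / N)"
      using sep[OF ST(1-4)] by (simp only: b_def N_def c_def)
    then have 1: "b < (s + N * N / 2) / N"
      unfolding vinner_divide_right vinner_add_left vinner_divide_left NN s_def .
    have "(\<lambda>l. X j l - (centroid X T l + centroid X S l) / 2) = (\<lambda>l. u j l - ?c l / 2)"
      "(\<lambda>l. centroid X T l - centroid X S l) = (\<lambda>l. - 1 * ?c l)"
      by (auto simp: u_eq[OF ST(2,5)] c_def field_simps)
    moreover have "vnorm d (\<lambda>l. - 1 * ?c l) = N"
      unfolding N_def vnorm_def vinner_scale_left vinner_scale_right by simp
    ultimately have "1/2 * sqrt ((1 / real (card T) + 1 / real (card S)) * (\<Sum>R\<in>\<Gamma>. K R))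
        < vinner d (\<lambda>l. u j l - ?c l / 2) (\<lambda>l. (-1 * ?c l) / N)"
      using sep[OF ST(2,1) ST(3)[symmetric] ST(5)] by metis
    then have 2: "b < (- t + N * N / 2) / N"
      unfolding vinner_divide_right vinner_scale_right vinner_diff_left vinner_divide_left NN t_def[symmetric]
      by (simp add: b_def add.commute)
    \<comment> \<open>If the centroids coincided, the quotient in fact \<open>1\<close> would be 0,
      as \<open>x / 0 = 0\<close>, and could not exceed \<open>b\<close>.\<close>
    have N: "0 < N" using 1 b0 vnorm_nonneg[of d ?c] by (cases "N = 0") (auto simp: N_def)
    \<comment> \<open>The separation of \<open>i\<close> seen from \<open>S\<close> is multiplied by
      that of \<open>j\<close> seen from \<open>T\<close>; four times the gap in this inequality is
      \<open>L i j - Q i j\<close>.\<close>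
    have "b * b < ((s + N * N / 2) / N) * ((- t + N * N / 2) / N)"
      using mult_strict_mono'[OF 1 2 b0 b0] .
    also have "\<dots> = (N * N + 2 * s - 2 * t - 4 * s * t / (N * N)) / 4"
      using N by (simp add: field_simps)
    finally have *: "z / (2 * real (card S)) + z / (2 * real (card T)) < N * N + 2 * s - 2 * t - 4 * (s * t / (N * N))"
      using bsq by (simp add: distrib_right)
    have ij: "i \<noteq> j" using ST P by (auto simp: is_partition_def)
    have "Q i j = - 2 * vinner d (u i) (u j) + 4 * (s * t / (N * N))"
      using ij by (simp add: Q_def reflect_form_def cl_eq[OF ST(1,4)] cl_eq[OF ST(2,5)]
          Zmat_blocks[OF P ST(1,2,4,5)] ST(3) NN s_def[symmetric] t_def[symmetric])
    moreover have "L i j = N * N - 2 * vinner d (u i) (u j) + 2 * s - 2 * t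
        - z / (2 * real (card S)) - z / (2 * real (card T))"
      using ij by (simp add: L_def lam_def sqd cl_eq[OF ST(1,4)] cl_eq[OF ST(2,5)] NN s_def[symmetric] t_def[symmetric])
    ultimately show ?thesis using * by linarith
  qed
  have Qpsd: "0 \<le> (\<Sum>i\<in>W. \<Sum>j\<in>W. q i * Q i j * q j)" for q
  proof -
    define a where "a S = (\<lambda>l. \<Sum>i\<in>S. q i * u i l)" for S
    define m where "m S = (\<Sum>i\<in>S. q i) / real (card S)" for S
    define w where "w S = (\<Sum>i\<in>S. (q i - m S)\<^sup>2)" for S
    have w0: "0 \<le> w S" for S by (simp add: w_def sum_nonneg)
    have a_le: "vnorm d (a S) \<le> sqrt (K S) * sqrt (w S)" if "S \<in> \<Gamma>" for S
    proof -
      \<comment> \<open>Centring \<open>q\<close> does not change \<open>a S\<close> because the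
        \<open>u i\<close> sum to 0 over \<open>S\<close>. Only the deviations \<open>w S\<close>
        then enter, and these are what the part \<open>z (I - Z\<^sub>\<Gamma>)\<close> of
        \<open>Q\<close> provides.\<close>
      have "a S = (\<lambda>l. \<Sum>i\<in>S. (q i - m S) * u i l)"
        using usum[OF that] by (simp add: a_def left_diff_distrib sum_subtractf sum_distrib_left[symmetric])
      then have "(vnorm d (a S))\<^sup>2 \<le> K S * w S"
        using vnorm_combination_le[OF K0[OF that] Ku[OF that], where w="\<lambda>i. q i - m S"] by (simp add: w_def)
      then show ?thesis by (simp add: real_le_rsqrt real_sqrt_mult[symmetric])
    qed
    have "(\<Sum>i\<in>W. \<Sum>j\<in>W. q i * Q i j * q j) =
        z * ((\<Sum>i\<in>W. \<Sum>j\<in>W. if j = i then (q i)\<^sup>2 else 0) - (\<Sum>i\<in>W. \<Sum>j\<in>W. (q i * q j) * Zmat \<Gamma> i j))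
        - 2 * (\<Sum>i\<in>W. \<Sum>j\<in>W. q i * reflect_form d (c (cl i) (cl j)) (u i) (u j) * q j)"
      unfolding sum_distrib_left sum_subtractf[symmetric]
      by (intro sum.cong refl) (simp add: Q_def algebra_simps power2_eq_square)
    also have "(\<Sum>i\<in>W. \<Sum>j\<in>W. if j = i then (q i)\<^sup>2 else 0) - (\<Sum>i\<in>W. \<Sum>j\<in>W. (q i * q j) * Zmat \<Gamma> i j) = (\<Sum>S\<in>\<Gamma>. w S)"
      (is "?l = _")
    proof -
      have "?l = (\<Sum>S\<in>\<Gamma>. (\<Sum>i\<in>S. (q i)\<^sup>2) - (\<Sum>i\<in>S. \<Sum>j\<in>S. q i * q j) / real (card S))"
      proof -
        have "(\<Sum>i\<in>W. \<Sum>j\<in>W. if j = i then (q i)\<^sup>2 else 0) = (\<Sum>i\<in>W. (q i)\<^sup>2)" using P(2) by simp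
        then show ?thesis
          unfolding sum_Zmat_form[OF P] by (simp add: sum_subtractf sum_partition[OF P, of "\<lambda>i. (q i)\<^sup>2"])
      qed
      also have "\<dots> = (\<Sum>S\<in>\<Gamma>. w S)"
        using finS cardS unfolding w_def m_def
        by (intro sum.cong refl sum_square_deviation[symmetric]) fastforce+
      finally show ?thesis .
    qed
    also have "(\<Sum>i\<in>W. \<Sum>j\<in>W. q i * reflect_form d (c (cl i) (cl j)) (u i) (u j) * q j) =
        (\<Sum>S\<in>\<Gamma>. \<Sum>T\<in>\<Gamma>. reflect_form d (c S T) (a S) (a T))"
      unfolding sum_sum_partition[OF P] a_def reflect_form_sum[symmetric]
      by (intro sum.cong refl) (simp add: cl_eq)
    finally have eq: "(\<Sum>i\<in>W. \<Sum>j\<in>W. q i * Q i j * q j) =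
        z * (\<Sum>S\<in>\<Gamma>. w S) - 2 * (\<Sum>S\<in>\<Gamma>. \<Sum>T\<in>\<Gamma>. reflect_form d (c S T) (a S) (a T))" .
    \<comment> \<open>Two uses of Cauchy-Schwarz, within pairs of clusters and then over all
      clusters, bound the reflected part by half of
      \<open>z * (\<Sum>S\<in>\<Gamma>. w S)\<close>.\<close>
    have "(\<Sum>S\<in>\<Gamma>. \<Sum>T\<in>\<Gamma>. reflect_form d (c S T) (a S) (a T)) \<le> (\<Sum>S\<in>\<Gamma>. \<Sum>T\<in>\<Gamma>. vnorm d (a S) * vnorm d (a T))"
      by (intro sum_mono reflect_form_le)
    also have "\<dots> = (\<Sum>S\<in>\<Gamma>. vnorm d (a S))\<^sup>2"
      by (simp add: sum_product power2_eq_square)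
    also have "\<dots> \<le> (\<Sum>S\<in>\<Gamma>. sqrt (K S) * sqrt (w S))\<^sup>2"
      by (intro power_mono sum_mono a_le sum_nonneg vnorm_nonneg)
    also have "\<dots> \<le> (\<Sum>S\<in>\<Gamma>. (sqrt (K S))\<^sup>2) * (\<Sum>S\<in>\<Gamma>. (sqrt (w S))\<^sup>2)"
      by (rule Cauchy_Schwarz_ineq_sum)
    also have "\<dots> = (\<Sum>S\<in>\<Gamma>. K S) * (\<Sum>S\<in>\<Gamma>. w S)"
      using K0 w0 by simp
    finally show ?thesis unfolding eq z_def by simp
  qed
  have LZ: "(\<Sum>i\<in>W. \<Sum>j\<in>W. L i j * Z i j) =
      (\<Sum>i\<in>W. \<Sum>j\<in>W. sqdist d X i j * Z i j) - 2 * (\<Sum>i\<in>W. lam i) + z * real k"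
    if Z: "pw_feasible W k Z" for Z
  proof -
    note F = Z[unfolded pw_feasible_def]
    have Zsym: "Z i j = Z j i" if "i \<in> W" "j \<in> W" for i j using F that by blast
    have row: "(\<Sum>j\<in>W. Z i j) = 1" if "i \<in> W" for i using F that by blast
    have col: "(\<Sum>i\<in>W. Z i j) = 1" if "j \<in> W" for j
    proof -
      have "(\<Sum>i\<in>W. Z i j) = (\<Sum>i\<in>W. Z j i)" by (rule sum.cong) (use Zsym that in auto)
      then show ?thesis using row[OF that] by simp
    qed
    have "(\<Sum>i\<in>W. \<Sum>j\<in>W. L i j * Z i j) = (\<Sum>i\<in>W. \<Sum>j\<in>W. sqdist d X i j * Z i j)
        - (\<Sum>i\<in>W. \<Sum>j\<in>W. lam i * Z i j) - (\<Sum>i\<in>W. \<Sum>j\<in>W. lam j * Z i j) + (\<Sum>i\<in>W. \<Sum>j\<in>W. if j = i then z * Z i i else 0)"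
      unfolding sum.distrib[symmetric] sum_subtractf[symmetric]
      by (intro sum.cong refl) (auto simp add: L_def algebra_simps)
    also have "(\<Sum>i\<in>W. \<Sum>j\<in>W. lam i * Z i j) = (\<Sum>i\<in>W. lam i)"
      by (simp add: sum_distrib_left[symmetric] row)
    also have "(\<Sum>i\<in>W. \<Sum>j\<in>W. lam j * Z i j) = (\<Sum>i\<in>W. lam i)"
      by (subst sum.swap) (simp add: sum_distrib_left[symmetric] col)
    also have "(\<Sum>i\<in>W. \<Sum>j\<in>W. if j = i then z * Z i i else 0) = z * real k"
      using F P(2) by (simp add: sum_distrib_left[symmetric])
    finally show ?thesis by simp
  qed
  \<comment> \<open>Complementary slackness: every diagonal block of \<open>Q\<close> sums to 0, the
    identity part since it cancels the block average and the reflected part since the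
    \<open>u i\<close> sum to 0.\<close>
  have L0: "(\<Sum>i\<in>W. \<Sum>j\<in>W. L i j * Zmat \<Gamma> i j) = 0"
  proof -
    have "(\<Sum>i\<in>S. \<Sum>j\<in>S. L i j) = 0" if S: "S \<in> \<Gamma>" for S
    proof -
      have "(\<Sum>i\<in>S. \<Sum>j\<in>S. L i j) = (\<Sum>i\<in>S. \<Sum>j\<in>S. z * ((if j = i then 1 else 0) - 1 / real (card S))
          - 2 * (1 * reflect_form d (c S S) (u i) (u j) * 1))"
        by (intro sum.cong refl) (auto simp: same[OF S] Q_def cl_eq[OF S] Zmat_blocks[OF P S S])
      also have "\<dots> = z * (\<Sum>i\<in>S. (\<Sum>j\<in>S. if j = i then 1 else 0) - (\<Sum>j\<in>S. 1 / real (card S)))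
          - 2 * (\<Sum>i\<in>S. \<Sum>j\<in>S. 1 * reflect_form d (c S S) (u i) (u j) * 1)"
        unfolding sum_distrib_left sum_subtractf by (simp only: sum_subtractf right_diff_distrib sum_distrib_left)
      also have "(\<Sum>i\<in>S. (\<Sum>j\<in>S. if j = i then 1 else 0) - (\<Sum>j\<in>S. 1 / real (card S))) = 0"
        using finS[OF S] cardS[OF S] by simp
      also have "(\<Sum>i\<in>S. \<Sum>j\<in>S. 1 * reflect_form d (c S S) (u i) (u j) * 1) = 0"
        unfolding reflect_form_sum by (simp add: usum[OF S] reflect_form_def vinner_def)
      finally show ?thesis by simp
    qed
    then show ?thesis unfolding sum_Zmat_form[OF P] by simp
  qed
  have main: "(\<Sum>i\<in>W. \<Sum>j\<in>W. sqdist d X i j * Zmat \<Gamma> i j) < (\<Sum>i\<in>W. \<Sum>j\<in>W. sqdist d X i j * Z i j)"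
    if Z: "pw_feasible W k Z" "Z \<noteq> Zmat \<Gamma>" for Z
  proof -
    note F = Z(1)[unfolded pw_feasible_def]
    \<comment> \<open>A feasible matrix other than \<open>Zmat \<Gamma>\<close> has a positive entry
      between two clusters, where \<open>L\<close> strictly exceeds \<open>Q\<close>.\<close>
    obtain S0 T0 i0 j0 where 0: "S0 \<in> \<Gamma>" "T0 \<in> \<Gamma>" "S0 \<noteq> T0" "i0 \<in> S0" "j0 \<in> T0" "Z i0 j0 \<noteq> 0"
      using feasible_block_diagonal_eq_Zmat[OF P Z(1)] Z(2) by blast
    have W0: "i0 \<in> W" "j0 \<in> W" using 0 partition_subset[OF P(1)] by auto
    have le: "0 \<le> (L i j - Q i j) * Z i j" if "i \<in> W" "j \<in> W" for i j
    proof (rule mult_nonneg_nonneg)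
      show "0 \<le> Z i j" using F that by blast
      show "0 \<le> L i j - Q i j"
        using same[OF cl_in(1)[OF that(1)] cl_in(2)[OF that(1)]] cl_in[OF that(2)]
          diff[OF cl_in(1)[OF that(1)] cl_in(1)[OF that(2)] _ cl_in(2)[OF that(1)] cl_in(2)[OF that(2)]]
        by (cases "cl i = cl j") auto
    qed
    have "0 < (L i0 j0 - Q i0 j0) * Z i0 j0"
    proof (rule mult_pos_pos)
      have "0 \<le> Z i0 j0" using F W0 by blast
      then show "0 < Z i0 j0" using 0 by simp
    qed (use diff[OF 0(1-5)] in simp)
    also have "\<dots> \<le> (\<Sum>j\<in>W. (L i0 j - Q i0 j) * Z i0 j)"
      by (rule member_le_sum) (use W0 P(2) le in auto)
    also have "\<dots> \<le> (\<Sum>i\<in>W. \<Sum>j\<in>W. (L i j - Q i j) * Z i j)"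
      by (rule member_le_sum[of i0 W "\<lambda>i. \<Sum>j\<in>W. (L i j - Q i j) * Z i j"]) (use W0 P(2) le in \<open>auto intro!: sum_nonneg\<close>)
    also have "\<dots> = (\<Sum>i\<in>W. \<Sum>j\<in>W. L i j * Z i j) - (\<Sum>i\<in>W. \<Sum>j\<in>W. Q i j * Z i j)"
      by (simp add: left_diff_distrib sum_subtractf)
    also have "\<dots> \<le> (\<Sum>i\<in>W. \<Sum>j\<in>W. L i j * Z i j)"
    proof -
      have "0 \<le> (\<Sum>i\<in>W. \<Sum>j\<in>W. Q i j * Z i j)"
        by (rule trace_psd_nonneg[OF P(2) _ _ Qpsd]) (use F in blast)+
      then show ?thesis by simp
    qed
    finally show ?thesis
      using L0 LZ[OF Z(1)] LZ[OF Zmat_feasible[OF P]] by simp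
  qed
  show ?thesis unfolding pw_unique_minimizer_def
  proof (intro conjI allI impI Zmat_feasible[OF P])
    fix Z assume Z: "pw_feasible W k Z \<and> Z \<noteq> Zmat \<Gamma>"
    \<comment> \<open>For empty \<open>W\<close> all feasible matrices are 0; otherwise the factor
      \<open>1 / (2 |W|)\<close> in the objective is positive and preserves strictness.\<close>
    then have "W \<noteq> {}" by (auto simp: pw_feasible_def fun_eq_iff Zmat_outside[OF P(1)])
    then have "0 < real (card W)" using P(2) by (simp add: card_gt_0_iff)
    then show "pw_objective d X W (Zmat \<Gamma>) < pw_objective d X W Z"
      unfolding pw_objective_def using main Z by (intro mult_strict_left_mono) auto
  qed
qed

section \<open>Concentration of Bernoulli samples\<close>

text \<open>For \<open>x = - y\<close> with \<open>y \<ge> 0\<close>, the claim amounts to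
  \<open>1 \<le> (1 - y + y\<^sup>2) * exp y\<close>, and already the quadratic Taylor polynomial of
  \<open>exp y\<close> makes this product at least 1.\<close>

lemma exp_le_quadratic:
  fixes x :: real
  assumes "\<bar>x\<bar> \<le> 1"
  shows "exp x \<le> 1 + x + x\<^sup>2"
proof (cases "0 \<le> x")
  case True
  then show ?thesis using exp_bound[of x] assms by simp
next
  case False
  define y where "y = - x"
  have y: "0 \<le> y" using False by (simp add: y_def)
  have "1 \<le> 1 + y\<^sup>2 / 2 + y^3 / 2 + y^4 / 2" using y by simp
  also have "\<dots> = (1 - y + y\<^sup>2) * (1 + y + y\<^sup>2 / 2)"
    by (simp add: field_simps power2_eq_square power3_eq_cube power4_eq_xxxx)
  also have "\<dots> \<le> (1 - y + y\<^sup>2) * exp y"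
  proof (rule mult_left_mono[OF exp_lower_Taylor_quadratic[OF y]])
    have "y \<le> 1" using assms by (simp add: y_def)
    then show "0 \<le> 1 - y + y\<^sup>2" using zero_le_power2[of y] by linarith
  qed
  finally show ?thesis by (simp add: y_def exp_minus field_simps)
qed

text \<open>The left-hand side is the expectation of \<open>exp ((B - p) * x)\<close> for a
  Bernoulli variable \<open>B\<close> of rate \<open>p\<close>. The factor \<open>p\<close> in the
  exponent on the right makes the tails depend on the expected sample size \<open>p n\<close>
  instead of \<open>n\<close>.\<close>

lemma bernoulli_exp_moment:
  fixes x p :: real
  assumes "0 \<le> p" "\<bar>x\<bar> \<le> 1"
  shows "exp ((1 - p) * x) * p + exp (- (p * x)) * (1 - p) \<le> exp (p * x\<^sup>2)"
proof -
  have "exp ((1 - p) * x) * p + exp (- (p * x)) * (1 - p) = exp (- (p * x)) * (1 + p * (exp x - 1))"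
    by (simp add: algebra_simps exp_add[symmetric])
  also have "\<dots> \<le> exp (- (p * x)) * exp (p * (x + x\<^sup>2))"
  proof (rule mult_left_mono)
    have "1 + p * (exp x - 1) \<le> 1 + p * (x + x\<^sup>2)"
      using exp_le_quadratic[OF assms(2)] assms(1) by (simp add: mult_left_mono)
    also have "\<dots> \<le> exp (p * (x + x\<^sup>2))" by (rule exp_ge_add_one_self)
    finally show "1 + p * (exp x - 1) \<le> exp (p * (x + x\<^sup>2))" .
  qed simp
  also have "\<dots> = exp (p * x\<^sup>2)" by (simp add: exp_add[symmetric] algebra_simps)
  finally show ?thesis .
qed

text \<open>Chernoff's method: independence factorises the exponential moment, and every factor is
  at most \<open>exp (p * ?t\<^sup>2)\<close>.\<close>

lemma bernoulli_upper_tail: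
  fixes y :: "'a \<Rightarrow> real"
  assumes A: "finite A" and y: "\<And>i. i \<in> A \<Longrightarrow> \<bar>y i\<bar> \<le> 1" and p: "0 \<le> p" "p \<le> 1" and \<eta>: "0 < \<eta>" "\<eta> \<le> 2"
  shows "measure_pmf.prob (Pi_pmf A False (\<lambda>_. bernoulli_pmf p))
      {b. \<eta> * p * real (card A) \<le> (\<Sum>i\<in>A. (of_bool (b i) - p) * y i)} \<le> exp (- (\<eta>\<^sup>2 * p * real (card A) / 4))"
proof -
  let ?M = "Pi_pmf A False (\<lambda>_. bernoulli_pmf p)" and ?f = "\<lambda>b. \<Sum>i\<in>A. (of_bool (b i) - p) * y i"
  \<comment> \<open>This parameter minimises the exponent
    \<open>(t\<^sup>2 - t * \<eta>) * p * ?N\<close>; the bound \<open>\<eta> \<le> 2\<close> keeps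
    \<open>?t * y i\<close> within the range of the moment estimate.\<close>
  let ?t = "\<eta> / 2" and ?N = "real (card A)"
  have expf: "exp (?t * ?f b) = (\<Prod>i\<in>A. exp (?t * ((of_bool (b i) - p) * y i)))" for b
    by (simp add: sum_distrib_left exp_sum[OF A])
  have int: "integrable (measure_pmf (bernoulli_pmf p)) g" for g :: "bool \<Rightarrow> real"
    by (rule integrable_measure_pmf_finite) simp
  have "measure_pmf.prob ?M {b \<in> UNIV. \<eta> * p * ?N \<le> ?f b} \<le>
      exp (- ?t * (\<eta> * p * ?N)) * (\<integral>b\<in>UNIV. exp (?t * ?f b) \<partial>?M)"
  proof (rule measure_pmf.Chernoff_ineq_ge)
    show "set_integrable (measure_pmf ?M) UNIV (\<lambda>b. exp (?t * ?f b))"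
      unfolding set_integrable_def expf using integrable_prod_Pi_pmf[where f="\<lambda>i b. exp (?t * ((of_bool b - p) * y i))" and p="\<lambda>_. bernoulli_pmf p" and dflt=False, OF A int] by simp
  qed (use \<eta> in auto)
  also have "(\<integral>b\<in>UNIV. exp (?t * ?f b) \<partial>?M) =
      (\<Prod>i\<in>A. measure_pmf.expectation (bernoulli_pmf p) (\<lambda>v. exp (?t * ((of_bool v - p) * y i))))"
    unfolding set_lebesgue_integral_def expf
    using expectation_prod_Pi_pmf[where f="\<lambda>i b. exp (?t * ((of_bool b - p) * y i))" and p="\<lambda>_. bernoulli_pmf p" and dflt=False, OF A int] by simp
  also have "\<dots> \<le> (\<Prod>i\<in>A. exp (p * ?t\<^sup>2))"
  proof (rule prod_mono, intro conjI)
    fix i assume i: "i \<in> A"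
    let ?x = "?t * y i"
    have "\<bar>?x\<bar> \<le> 1 * 1" unfolding abs_mult by (rule mult_mono) (use \<eta> y[OF i] in auto)
    then have "exp ((1 - p) * ?x) * p + exp (- (p * ?x)) * (1 - p) \<le> exp (p * ?x\<^sup>2)"
      by (intro bernoulli_exp_moment p) simp
    also have "exp (p * ?x\<^sup>2) \<le> exp (p * ?t\<^sup>2)"
    proof -
      have "(y i)\<^sup>2 \<le> 1" using y[OF i] by (simp add: abs_square_le_1)
      then have "?x\<^sup>2 \<le> ?t\<^sup>2"
        unfolding power_mult_distrib using mult_left_mono[of "(y i)\<^sup>2" 1 "?t\<^sup>2"] by simp
      then show ?thesis using p by (simp add: mult_left_mono)
    qed
    also have "exp ((1 - p) * ?x) * p + exp (- (p * ?x)) * (1 - p) =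
        measure_pmf.expectation (bernoulli_pmf p) (\<lambda>v. exp (?t * ((of_bool v - p) * y i)))"
    proof -
      have "(1 - p) * ?x = ?t * ((1 - p) * y i)" "- (p * ?x) = ?t * ((0 - p) * y i)" by simp_all
      then show ?thesis using p by (simp add: mult_ac)
    qed
    finally show "measure_pmf.expectation (bernoulli_pmf p) (\<lambda>v. exp (?t * ((of_bool v - p) * y i))) \<le> exp (p * ?t\<^sup>2)" .
    show "0 \<le> measure_pmf.expectation (bernoulli_pmf p) (\<lambda>v. exp (?t * ((of_bool v - p) * y i)))"
      by (rule Bochner_Integration.integral_nonneg) simp
  qed
  also have "(\<Prod>i\<in>A. exp (p * ?t\<^sup>2)) = exp (?N * (p * ?t\<^sup>2))"
    by (simp add: exp_of_nat_mult)
  also have "exp (- ?t * (\<eta> * p * ?N)) * exp (?N * (p * ?t\<^sup>2)) = exp (- (\<eta>\<^sup>2 * p * ?N / 4))"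
    by (simp add: exp_add[symmetric] field_simps power2_eq_square)
  finally show ?thesis by simp
qed

text \<open>A union bound over \<open>I\<close> and over both signs of \<open>y\<close>, which
  explains the factor 2, transported to the random set along its defining map.\<close>

lemma bernoulli_sample_deviation:
  fixes y :: "'c \<Rightarrow> nat \<Rightarrow> real"
  assumes I: "finite I" and y: "\<And>c i. c \<in> I \<Longrightarrow> i \<in> {1..n} \<Longrightarrow> \<bar>y c i\<bar> \<le> 1"
    and p: "0 \<le> p" "p \<le> 1" and \<eta>: "0 < \<eta>" "\<eta> \<le> 2"
  shows "1 - 2 * real (card I) * exp (- (\<eta>\<^sup>2 * p * real n / 4)) \<le>
    measure_pmf.prob (bernoulli_sample n p)
      {W. W \<subseteq> {1..n} \<and> (\<forall>c\<in>I. \<bar>(\<Sum>i\<in>W. y c i) - p * (\<Sum>i\<in>{1..n}. y c i)\<bar> \<le> \<eta> * p * real n)}"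
proof -
  let ?M = "Pi_pmf {1..n} False (\<lambda>_. bernoulli_pmf p)" and ?W = "\<lambda>b. {i \<in> {1..n}. b i}"
  let ?e = "exp (- (\<eta>\<^sup>2 * p * real n / 4))"
  let ?G = "{W. W \<subseteq> {1..n} \<and> (\<forall>c\<in>I. \<bar>(\<Sum>i\<in>W. y c i) - p * (\<Sum>i\<in>{1..n}. y c i)\<bar> \<le> \<eta> * p * real n)}"
  define B where "B s c = {b. \<eta> * p * real (card {1..n}) \<le> (\<Sum>i\<in>{1..n}. (of_bool (b i) - p) * (s * y c i))}" for s :: real and c
  have dev: "(\<Sum>i\<in>?W b. y c i) - p * (\<Sum>i\<in>{1..n}. y c i) = (\<Sum>i\<in>{1..n}. (of_bool (b i) - p) * y c i)" for b c
  proof -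
    have "(\<Sum>i\<in>?W b. y c i) = (\<Sum>i\<in>{1..n}. of_bool (b i) * y c i)"
      by (simp add: sum.If_cases Int_def Collect_conj_eq[symmetric] of_bool_def if_distrib[of "\<lambda>x. x * _"] cong: if_cong)
    then show ?thesis by (simp add: left_diff_distrib sum_subtractf sum_distrib_left)
  qed
  have "measure_pmf.prob ?M (\<Union>c\<in>I. B 1 c \<union> B (-1) c) \<le> (\<Sum>c\<in>I. measure_pmf.prob ?M (B 1 c \<union> B (-1) c))"
    by (rule measure_UNION_le[OF I]) simp
  also have "\<dots> \<le> (\<Sum>c\<in>I. ?e + ?e)"
  proof (rule sum_mono)
    fix c assume c: "c \<in> I"
    have "measure_pmf.prob ?M (B s c) \<le> ?e" if "\<bar>s\<bar> = 1" for s
      using bernoulli_upper_tail[of "{1..n}" "\<lambda>i. s * y c i" p \<eta>] y[OF c] p \<eta> that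
      by (simp add: B_def abs_mult)
    then have "measure_pmf.prob ?M (B 1 c) \<le> ?e" "measure_pmf.prob ?M (B (-1) c) \<le> ?e" by simp_all
    moreover have "measure_pmf.prob ?M (B 1 c \<union> B (-1) c) \<le> measure_pmf.prob ?M (B 1 c) + measure_pmf.prob ?M (B (-1) c)"
      by (rule measure_Un_le) simp_all
    ultimately show "measure_pmf.prob ?M (B 1 c \<union> B (-1) c) \<le> ?e + ?e" by linarith
  qed
  finally have bad: "measure_pmf.prob ?M (\<Union>c\<in>I. B 1 c \<union> B (-1) c) \<le> 2 * real (card I) * ?e" by simp
  have sub: "- (\<Union>c\<in>I. B 1 c \<union> B (-1) c) \<subseteq> ?W -` ?G"
  proof
    fix b assume b: "b \<in> - (\<Union>c\<in>I. B 1 c \<union> B (-1) c)"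
    have "\<bar>(\<Sum>i\<in>?W b. y c i) - p * (\<Sum>i\<in>{1..n}. y c i)\<bar> \<le> \<eta> * p * real n" if "c \<in> I" for c
    proof -
      have "b \<notin> B 1 c" "b \<notin> B (-1) c" using b that by auto
      then show ?thesis unfolding dev by (simp add: B_def sum_negf)
    qed
    then show "b \<in> ?W -` ?G" by auto
  qed
  have "1 - 2 * real (card I) * ?e \<le> 1 - measure_pmf.prob ?M (\<Union>c\<in>I. B 1 c \<union> B (-1) c)"
    using bad by simp
  also have "\<dots> = measure_pmf.prob ?M (- (\<Union>c\<in>I. B 1 c \<union> B (-1) c))"
    using measure_pmf.prob_compl[of "\<Union>c\<in>I. B 1 c \<union> B (-1) c" ?M] by (simp add: Compl_eq_Diff_UNIV)
  also have "\<dots> \<le> measure_pmf.prob ?M (?W -` ?G)"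
    by (rule measure_pmf.finite_measure_mono[OF sub]) simp
  also have "\<dots> = measure_pmf.prob (bernoulli_sample n p) ?G"
    unfolding bernoulli_sample_def by (simp only: measure_map_pmf)
  finally show ?thesis .
qed

section \<open>Operator norms and perturbation of the separation\<close>

lemma sum_vinner_squares_le:
  assumes "finite R" "\<And>i. i \<in> R \<Longrightarrow> vnorm d (u i) \<le> r"
  shows "(\<Sum>i\<in>R. (vinner d y (u i))\<^sup>2) \<le> (real (card R) * r\<^sup>2) * vinner d y y"
proof -
  have "(vinner d y (u i))\<^sup>2 \<le> r\<^sup>2 * vinner d y y" if "i \<in> R" for i
  proof -
    have "\<bar>vinner d y (u i)\<bar> \<le> vnorm d y * vnorm d (u i)" by (rule abs_vinner_le_vnorm)
    also have "\<dots> \<le> vnorm d y * r" by (intro mult_left_mono assms(2) that vnorm_nonneg)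
    finally have "(vinner d y (u i))\<^sup>2 \<le> (vnorm d y * r)\<^sup>2" by (metis abs_ge_zero power2_abs power_mono)
    then show ?thesis by (simp add: power_mult_distrib vnorm_squared mult.commute)
  qed
  then have "(\<Sum>i\<in>R. (vinner d y (u i))\<^sup>2) \<le> (\<Sum>i\<in>R. r\<^sup>2 * vinner d y y)" by (rule sum_mono)
  then show ?thesis by simp
qed

context
  fixes d :: nat and A R :: "nat set" and X :: "nat \<Rightarrow> nat \<Rightarrow> real" and r :: real
  assumes A: "finite A" "R \<subseteq> A"
    and r: "\<And>i. i \<in> R \<Longrightarrow> vnorm d (\<lambda>j. X i j - centroid X R j) \<le> r"
begin

text \<open>Shows that the set whose supremum defines \<open>opnorm\<close> is bounded above, so
  that the real supremum has its usual properties.\<close>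

lemma opnorm_set_bound:
  assumes v: "(\<Sum>i\<in>A. (v i)\<^sup>2) \<le> 1"
  shows "vnorm d (\<lambda>j. \<Sum>i\<in>R. (X i j - centroid X R j) * v i) \<le> sqrt (real (card R) * r\<^sup>2)"
proof (rule real_le_rsqrt)
  have R: "finite R" using A finite_subset by blast
  have "(vnorm d (\<lambda>j. \<Sum>i\<in>R. v i * (X i j - centroid X R j)))\<^sup>2 \<le> real (card R) * r\<^sup>2 * (\<Sum>i\<in>R. (v i)\<^sup>2)"
    by (rule vnorm_combination_le[where u="\<lambda>i j. X i j - centroid X R j"])
      (use sum_vinner_squares_le[OF R, of d "\<lambda>i j. X i j - centroid X R j" r] r in auto)
  also have "\<dots> \<le> real (card R) * r\<^sup>2 * 1"
  proof (rule mult_left_mono)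
    have "(\<Sum>i\<in>R. (v i)\<^sup>2) \<le> (\<Sum>i\<in>A. (v i)\<^sup>2)" by (rule sum_mono2) (use A in auto)
    then show "(\<Sum>i\<in>R. (v i)\<^sup>2) \<le> 1" using v by simp
  qed simp
  finally show "(vnorm d (\<lambda>j. \<Sum>i\<in>R. (X i j - centroid X R j) * v i))\<^sup>2 \<le> real (card R) * r\<^sup>2"
    by (simp add: mult.commute)
qed

lemma vnorm_le_opnorm:
  assumes "(\<Sum>i\<in>A. (v i)\<^sup>2) \<le> 1"
  shows "vnorm d (\<lambda>j. \<Sum>i\<in>R. (X i j - centroid X R j) * v i) \<le> opnorm d A X R"
  unfolding opnorm_def
proof (rule cSup_upper)
  show "bdd_above {vnorm d (\<lambda>j. \<Sum>i\<in>R. (X i j - centroid X R j) * v i) |v. (\<Sum>i\<in>A. (v i)\<^sup>2) \<le> 1}"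
    using opnorm_set_bound by (intro bdd_aboveI) blast
qed (use assms in blast)

lemma opnorm_nonneg: "0 \<le> opnorm d A X R"
  by (rule order_trans[OF vnorm_nonneg vnorm_le_opnorm[of "\<lambda>_. 0"]]) simp

lemma opnorm_squared_le: "(opnorm d A X R)\<^sup>2 \<le> real (card R) * r\<^sup>2"
proof -
  have "opnorm d A X R \<le> sqrt (real (card R) * r\<^sup>2)"
    unfolding opnorm_def
  proof (rule cSup_least)
    have "vnorm d (\<lambda>j. \<Sum>i\<in>R. (X i j - centroid X R j) * 0) \<in>
        {vnorm d (\<lambda>j. \<Sum>i\<in>R. (X i j - centroid X R j) * v i) |v. (\<Sum>i\<in>A. (v i)\<^sup>2) \<le> 1}"
      by (intro CollectI exI[of _ "\<lambda>_. 0"]) simp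
    then show "{vnorm d (\<lambda>j. \<Sum>i\<in>R. (X i j - centroid X R j) * v i) |v. (\<Sum>i\<in>A. (v i)\<^sup>2) \<le> 1} \<noteq> {}"
      by blast
  qed (use opnorm_set_bound in blast)
  then have "(opnorm d A X R)\<^sup>2 \<le> (sqrt (real (card R) * r\<^sup>2))\<^sup>2"
    by (intro power_mono opnorm_nonneg)
  then show ?thesis by simp
qed

text \<open>The unit vector \<open>v\<close> proportional to the inner products on \<open>R\<close>,
  and zero off \<open>R\<close>, attains \<open>sqrt s\<close> when its image is paired with
  \<open>y\<close>. This puts the operator norm into the form required of \<open>K\<close> in the
  certificate.\<close>

lemma covariance_le_opnorm:
  "(\<Sum>i\<in>R. (vinner d y (\<lambda>j. X i j - centroid X R j))\<^sup>2) \<le> (opnorm d A X R)\<^sup>2 * vinner d y y"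
proof -
  let ?u = "\<lambda>i j. X i j - centroid X R j"
  let ?q = "\<lambda>i. vinner d y (?u i)"
  define s where "s = (\<Sum>i\<in>R. (?q i)\<^sup>2)"
  have s0: "0 \<le> s" by (simp add: s_def sum_nonneg)
  show ?thesis
  proof (cases "s = 0")
    case True
    then show ?thesis using vinner_self_nonneg[of d y] by (simp add: s_def[symmetric])
  next
    case False
    define v where "v i = (if i \<in> R then ?q i / sqrt s else 0)" for i
    have "(\<Sum>i\<in>A. (v i)\<^sup>2) = (\<Sum>i\<in>R. (v i)\<^sup>2)"
      by (rule sum.mono_neutral_right) (use A in \<open>auto simp: v_def\<close>)
    also have "\<dots> = (\<Sum>i\<in>R. (?q i)\<^sup>2 / s)"
      using s0 by (intro sum.cong) (auto simp: v_def power_divide)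
    also have "\<dots> = 1" using False by (simp add: s_def[symmetric] sum_divide_distrib[symmetric])
    finally have v1: "(\<Sum>i\<in>A. (v i)\<^sup>2) = 1" .
    have "sqrt s = s / sqrt s" using s0 by (simp add: real_div_sqrt)
    also have "\<dots> = (\<Sum>i\<in>R. v i * ?q i)"
      by (simp add: s_def v_def sum_divide_distrib power2_eq_square)
    also have "\<dots> = vinner d y (\<lambda>j. \<Sum>i\<in>R. v i * ?u i j)"
      by (rule vinner_sum_right[symmetric])
    also have "\<dots> \<le> vnorm d y * vnorm d (\<lambda>j. \<Sum>i\<in>R. ?u i j * v i)"
      using vinner_le_vnorm[of d y "\<lambda>j. \<Sum>i\<in>R. v i * ?u i j"] by (simp add: mult.commute)
    also have "\<dots> \<le> vnorm d y * opnorm d A X R"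
      by (intro mult_left_mono vnorm_nonneg vnorm_le_opnorm) (simp add: v1)
    finally have "(sqrt s)\<^sup>2 \<le> (vnorm d y * opnorm d A X R)\<^sup>2"
      using s0 by (intro power_mono) auto
    then show ?thesis using s0 by (simp add: s_def[symmetric] power_mult_distrib vnorm_squared mult.commute)
  qed
qed

end

section \<open>Separation of a point by two centres that may be moved\<close>

definition separation :: "nat \<Rightarrow> (nat \<Rightarrow> real) \<Rightarrow> (nat \<Rightarrow> real) \<Rightarrow> (nat \<Rightarrow> real) \<Rightarrow> real" where
  "separation d x a b = vinner d (\<lambda>l. x l - (a l + b l) / 2) (\<lambda>l. (a l - b l) / vnorm d (\<lambda>l. a l - b l))"

text \<open>Polarisation. The sign of the separation tells which centre is closer, and perturbing
  the centres reduces to triangle inequalities for three distances.\<close>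

lemma separation_eq:
  "separation d x a b =
    ((vnorm d (\<lambda>l. x l - b l))\<^sup>2 - (vnorm d (\<lambda>l. x l - a l))\<^sup>2) / (2 * vnorm d (\<lambda>l. a l - b l))"
proof -
  have eq: "vinner d (\<lambda>l. x l - (a l + b l) / 2) (\<lambda>l. a l - b l) =
      (vinner d (\<lambda>l. x l - b l) (\<lambda>l. x l - b l) - vinner d (\<lambda>l. x l - a l) (\<lambda>l. x l - a l)) / 2"
    unfolding vinner_def by (simp add: sum_subtractf[symmetric] sum_divide_distrib field_simps power2_eq_square)
  show ?thesis
    unfolding separation_def vnorm_squared vinner_divide_right eq by (simp only: divide_divide_eq_left)
qed

text \<open>Moving both centres by \<delta> lowers the numerator, divided by \<open>2 * D\<close>,
  by at most \<open>2 * \<delta>\<close>. Replacing \<open>D\<close> by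
  \<open>D' \<le> D + 2 * \<delta>\<close> costs at most \<open>2 * \<delta>\<close> more, because
  the separation is at most \<open>D\<close>.\<close>

lemma separation_perturb:
  assumes xa: "vnorm d (\<lambda>l. x l - a l) \<le> r" and ab: "2 * r \<le> vnorm d (\<lambda>l. a l - b l)"
    and a': "vnorm d (\<lambda>l. a' l - a l) \<le> \<delta>" and b': "vnorm d (\<lambda>l. b' l - b l) \<le> \<delta>"
    and g: "0 < separation d x a b" "4 * \<delta> \<le> separation d x a b"
  shows "separation d x a b - 4 * \<delta> \<le> separation d x a' b'"
proof -
  define D where "D = vnorm d (\<lambda>l. a l - b l)"
  define D' where "D' = vnorm d (\<lambda>l. a' l - b' l)"
  define p where "p = vnorm d (\<lambda>l. x l - a l)"
  define q where "q = vnorm d (\<lambda>l. x l - b l)"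
  define p' where "p' = vnorm d (\<lambda>l. x l - a' l)"
  define q' where "q' = vnorm d (\<lambda>l. x l - b' l)"
  define g where "g = separation d x a b"
  note defs = D_def D'_def p_def q_def p'_def q'_def
  have nn: "0 \<le> D" "0 \<le> D'" "0 \<le> p" "0 \<le> q" "0 \<le> p'" "0 \<le> q'" "0 \<le> \<delta>"
    using order_trans[OF vnorm_nonneg a'] by (simp_all add: defs vnorm_nonneg)
  have g_eq: "g = (q\<^sup>2 - p\<^sup>2) / (2 * D)" and g'_eq: "separation d x a' b' = (q'\<^sup>2 - p'\<^sup>2) / (2 * D')"
    unfolding g_def defs by (rule separation_eq)+
  have g0: "0 < g" "4 * \<delta> \<le> g" using g by (simp_all add: g_def)
  then have D: "0 < D" using nn g_eq by (cases "D = 0") auto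
  have aa: "vnorm d (\<lambda>l. a l - a' l) \<le> \<delta>" and bb: "vnorm d (\<lambda>l. b l - b' l) \<le> \<delta>"
    using a' b' vnorm_diff_commute[of d a a'] vnorm_diff_commute[of d b b'] by simp_all
  have p': "p' \<le> p + \<delta>" unfolding defs using vnorm_diff_triangle[of d x a' a] aa by simp
  have q': "q - \<delta> \<le> q'" unfolding defs using vnorm_diff_triangle[of d x b b'] b' by simp
  have D'1: "D' \<le> D + 2 * \<delta>"
    unfolding defs using vnorm_diff_triangle[of d a' b' a] vnorm_diff_triangle[of d a b' b] a' bb by simp
  have D'2: "D \<le> D' + 2 * \<delta>"
    unfolding defs using vnorm_diff_triangle[of d a b a'] vnorm_diff_triangle[of d a' b b'] aa b' by simp
  have qp: "q - p \<le> D" unfolding defs using vnorm_diff_triangle[of d x b a] by simp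
  \<comment> \<open>Here the radius being at most half the distance of the centres enters:
    \<open>q + p \<le> D + 2 * p\<close>.\<close>
  have pq: "q + p \<le> 2 * D" using qp xa ab unfolding defs by simp
  have "2 * D * g = q\<^sup>2 - p\<^sup>2" using D by (simp add: g_eq)
  then have gD: "2 * D * g = (q - p) * (q + p)" by (simp add: power2_eq_square algebra_simps)
  \<comment> \<open>By \<open>gD\<close>, \<open>g\<close> is \<open>q - p\<close> times the ratio
    \<open>(q + p) / (2 * D)\<close>, which is at most 1.\<close>
  have qp4: "g \<le> q - p"
  proof (rule ccontr)
    assume "\<not> g \<le> q - p"
    then have lt: "q - p < g" by simp
    have "(q - p) * (q + p) \<le> (q - p) * (2 * D) \<or> q - p < 0"
      using pq by (metis mult_left_mono not_le)
    moreover have "(q - p) * (2 * D) < g * (2 * D)" using lt D by simp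
    moreover have "0 < (q - p) * (q + p)" using gD[symmetric] D g0 by simp
    ultimately have "q - p < 0" using gD by (auto simp: algebra_simps)
    then have "(q - p) * (q + p) \<le> 0" using nn by (simp add: mult_nonpos_nonneg)
    with \<open>0 < (q - p) * (q + p)\<close> show False by simp
  qed
  have D'0: "0 < D'" using D'2 qp4 qp g0 nn D by linarith
  have "2 * D * (g - 2 * \<delta>) \<le> q'\<^sup>2 - p'\<^sup>2"
  proof -
    have "(q - \<delta>)\<^sup>2 \<le> q'\<^sup>2" using q' qp4 g0 nn by (intro power_mono) auto
    moreover have "p'\<^sup>2 \<le> (p + \<delta>)\<^sup>2" using p' nn by (intro power_mono)
    moreover have "(q - \<delta>)\<^sup>2 - (p + \<delta>)\<^sup>2 = 2 * D * g - 2 * \<delta> * (q + p)"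
      unfolding gD by (simp add: power2_eq_square algebra_simps)
    moreover have "\<delta> * (q + p) \<le> \<delta> * (2 * D)" using pq nn by (intro mult_left_mono)
    ultimately show ?thesis by (simp add: algebra_simps)
  qed
  then have "2 * D * (g - 2 * \<delta>) / (2 * D') \<le> separation d x a' b'"
    unfolding g'_eq using D'0 by (intro divide_right_mono) auto
  moreover have "g - 4 * \<delta> \<le> 2 * D * (g - 2 * \<delta>) / (2 * D')"
  proof -
    have "(g - 4 * \<delta>) * D' \<le> (g - 4 * \<delta>) * (D + 2 * \<delta>)"
      using g0 D'1 by (intro mult_left_mono) auto
    also have "\<dots> = D * (g - 2 * \<delta>) - 2 * \<delta> * (D - g) - 8 * (\<delta> * \<delta>)" by (simp add: algebra_simps)
    also have "\<dots> \<le> D * (g - 2 * \<delta>)"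
    proof -
      have "0 \<le> \<delta> * (D - g)" using nn qp qp4 by (intro mult_nonneg_nonneg) auto
      moreover have "0 \<le> \<delta> * \<delta>" by simp
      ultimately show ?thesis by linarith
    qed
    finally show ?thesis using D'0 by (simp add: field_simps)
  qed
  ultimately show ?thesis unfolding g_def by linarith
qed

section \<open>Bounds read off from the extremal quantities, and covariance estimates\<close>

lemma finite_image_pairs:
  assumes "finite A" "finite B" "\<And>S T. P S T \<Longrightarrow> S \<in> A \<and> T \<in> B"
  shows "finite {f S T | S T. P S T}"
proof (rule finite_subset)
  show "{f S T | S T. P S T} \<subseteq> (\<lambda>(S, T). f S T) ` (A \<times> B)" using assms(3) by force
  show "finite ((\<lambda>(S, T). f S T) ` (A \<times> B))" using assms by simp
qed

lemma beta_add_prox_le_separation: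
  assumes P: "is_partition A k \<Gamma>" "finite A" and ST: "S \<in> \<Gamma>" "T \<in> \<Gamma>" "S \<noteq> T" "i \<in> S"
  shows "beta d A X \<Gamma> S T + prox d A X \<Gamma> \<le> separation d (X i) (centroid X S) (centroid X T)"
proof -
  have "prox d A X \<Gamma> \<le> alpha d X S T - beta d A X \<Gamma> S T"
    unfolding prox_def
    by (rule Min_le[OF finite_image_pairs[OF partition_finite(1)[OF P] partition_finite(1)[OF P]]])
      (use ST in auto)
  moreover have "alpha d X S T \<le> separation d (X i) (centroid X S) (centroid X T)"
    unfolding alpha_def separation_def using partition_finite(2)[OF P ST(1)] ST by (intro Min_le) auto
  ultimately show ?thesis by simp
qed

lemma Delta_le:
  assumes P: "is_partition A k \<Gamma>" "finite A" and ST: "S \<in> \<Gamma>" "T \<in> \<Gamma>" "S \<noteq> T"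
  shows "Delta d X \<Gamma> \<le> vnorm d (\<lambda>j. centroid X S j - centroid X T j)"
  unfolding Delta_def
  by (rule Min_le[OF finite_image_pairs[OF partition_finite(1)[OF P] partition_finite(1)[OF P]]])
    (use ST in auto)

lemma le_rad:
  assumes P: "is_partition A k \<Gamma>" "finite A" and S: "S \<in> \<Gamma>" "i \<in> S"
  shows "vnorm d (\<lambda>j. X i j - centroid X S j) \<le> rad d X \<Gamma>"
  unfolding rad_def
  by (rule Max_ge[OF finite_image_pairs[OF partition_finite(1)[OF P] P(2)]])
    (use S partition_subset[OF P(1)] in auto)

lemma pi_min_le:
  assumes P: "is_partition {1..n} k \<Gamma>" and S: "S \<in> \<Gamma>"
  shows "pi_min n \<Gamma> * real n \<le> real (card S)"
proof -
  have "Min (card ` \<Gamma>) \<le> card S" using partition_finite(1)[OF P] S by (intro Min_le) auto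
  then show ?thesis by (cases "n = 0") (simp_all add: pi_min_def)
qed

lemma pi_min_pos:
  assumes P: "is_partition {1..n} k \<Gamma>" and "0 < k"
  shows "0 < pi_min n \<Gamma>"
proof -
  have fin: "finite \<Gamma>" using partition_finite(1)[OF P] by simp
  have ne: "\<Gamma> \<noteq> {}" using assms by (auto simp: is_partition_def)
  then have "0 < Min (card ` \<Gamma>)" using fin partition_finite(3)[OF P] by simp
  moreover have "n \<noteq> 0"
  proof
    assume "n = 0"
    then show False using ne P by (auto simp: is_partition_def)
  qed
  ultimately show ?thesis by (simp add: pi_min_def)
qed

text \<open>The second moment is least about the mean. The covariance of a sample may therefore be
  bounded about the centroid of the full cluster, which does not depend on the sample.\<close>

lemma centered_covariance_le:
  assumes "finite S"
  shows "(\<Sum>i\<in>S. (vinner d y (\<lambda>l. X i l - centroid X S l))\<^sup>2) \<le> (\<Sum>i\<in>S. (vinner d y (\<lambda>l. X i l - c l))\<^sup>2)"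
proof (cases "S = {}")
  case False
  let ?q = "\<lambda>i. vinner d y (\<lambda>l. X i l - c l)"
  let ?m = "(\<Sum>i\<in>S. ?q i) / real (card S)"
  have c: "real (card S) > 0" using assms False by (simp add: card_gt_0_iff)
  have "vinner d y (\<lambda>l. centroid X S l) = (\<Sum>i\<in>S. vinner d y (X i)) / real (card S)"
    using vinner_sum_right[of d y "\<lambda>_. 1" X S] by (simp add: centroid_def vinner_divide_right)
  then have m: "vinner d y (\<lambda>l. X i l - centroid X S l) = ?q i - ?m" for i
    using c by (simp add: vinner_diff_right sum_subtractf diff_divide_distrib)
  have "(\<Sum>i\<in>S. (vinner d y (\<lambda>l. X i l - centroid X S l))\<^sup>2) =
      (\<Sum>i\<in>S. (?q i)\<^sup>2) - (\<Sum>i\<in>S. \<Sum>j\<in>S. ?q i * ?q j) / real (card S)"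
    unfolding m by (rule sum_square_deviation[OF assms False])
  also have "(\<Sum>i\<in>S. \<Sum>j\<in>S. ?q i * ?q j) = (\<Sum>i\<in>S. ?q i)\<^sup>2"
    by (simp add: sum_product power2_eq_square)
  finally show ?thesis by simp
qed simp

text \<open>Expresses the form by the entries of the covariance matrix, which concentration controls
  one by one.\<close>

lemma covariance_expand:
  "(\<Sum>i\<in>S. (vinner d y (u i))\<^sup>2) = (\<Sum>j<d. \<Sum>l<d. y j * y l * (\<Sum>i\<in>S. u i j * u i l))"
proof -
  have "(\<Sum>i\<in>S. (vinner d y (u i))\<^sup>2) = (\<Sum>i\<in>S. \<Sum>j<d. \<Sum>l<d. y j * y l * (u i j * u i l))"
    by (simp add: vinner_def power2_eq_square sum_product algebra_simps)
  also have "\<dots> = (\<Sum>j<d. \<Sum>i\<in>S. \<Sum>l<d. y j * y l * (u i j * u i l))"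
    by (rule sum.swap)
  also have "\<dots> = (\<Sum>j<d. \<Sum>l<d. \<Sum>i\<in>S. y j * y l * (u i j * u i l))"
    by (intro sum.cong refl sum.swap)
  finally show ?thesis by (simp add: sum_distrib_left)
qed

text \<open>A matrix with entries at most \<open>e\<close> in absolute value has spectral norm at
  most \<open>d e\<close>, since the squared 1-norm of \<open>y\<close> is at most \<open>d\<close>
  times its squared Euclidean norm.\<close>

lemma quadratic_form_le:
  assumes "\<And>j l. j < d \<Longrightarrow> l < d \<Longrightarrow> \<bar>E j l\<bar> \<le> e"
  shows "(\<Sum>j<d. \<Sum>l<d. y j * y l * E j l) \<le> real d * e * vinner d y y"
proof (cases "d = 0")
  case False
  have e: "0 \<le> e" using assms[of 0 0] False by (meson abs_ge_zero order_trans not_gr_zero)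
  have "(\<Sum>j<d. \<Sum>l<d. y j * y l * E j l) \<le> (\<Sum>j<d. \<Sum>l<d. \<bar>y j\<bar> * \<bar>y l\<bar> * e)"
  proof (intro sum_mono)
    fix j l assume "j \<in> {..<d}" "l \<in> {..<d}"
    then have "\<bar>y j * y l\<bar> * \<bar>E j l\<bar> \<le> \<bar>y j * y l\<bar> * e" by (intro mult_left_mono assms) auto
    then show "y j * y l * E j l \<le> \<bar>y j\<bar> * \<bar>y l\<bar> * e"
      by (metis abs_ge_self abs_mult order_trans)
  qed
  also have "\<dots> = e * (\<Sum>j<d. \<bar>y j\<bar>)\<^sup>2"
    by (simp add: power2_eq_square sum_product sum_distrib_left mult_ac)
  also have "\<dots> \<le> e * (real d * vinner d y y)"
  proof (rule mult_left_mono[OF _ e])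
    have "(\<Sum>j<d. 1 * \<bar>y j\<bar>)\<^sup>2 \<le> (\<Sum>j<d. 1\<^sup>2) * (\<Sum>j<d. \<bar>y j\<bar>\<^sup>2)"
      by (rule Cauchy_Schwarz_ineq_sum)
    then show "(\<Sum>j<d. \<bar>y j\<bar>)\<^sup>2 \<le> real d * vinner d y y"
      by (simp add: vinner_def power2_eq_square)
  qed
  finally show ?thesis by (simp add: mult_ac)
qed (simp add: vinner_def)

text \<open>Here \<open>h\<close> and \<open>h'\<close> stand for \<open>1/|S| + 1/|T|\<close> in the full data and in the sample, \<open>V\<close> for the
  sum of the squared operator norms, and \<open>m\<close> for \<open>k d\<close>.\<close>
lemma beta_perturb:
  fixes h h' V r b n :: real
  assumes \<theta>: "0 < \<theta>" "\<theta> \<le> 1/2" and pos: "0 < p" "0 < \<pi>" "0 < n" "0 \<le> V" "0 \<le> h" "0 \<le> b" "0 \<le> m"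
    and h': "h' * (p * (1 - \<theta>)) \<le> h" and h: "h * (\<pi> * n) \<le> 2" and V: "V \<le> n * r\<^sup>2"
    and b: "4 * \<theta> * (1 / \<pi> + m) * r\<^sup>2 \<le> b\<^sup>2"
  shows "1/2 * sqrt (h' * (p * V + m * (\<theta> * \<pi> * p * n * r\<^sup>2))) \<le> 1/2 * sqrt (h * V) + b / 2"
proof -
  define w where "w = V + m * (\<theta> * \<pi> * n * r\<^sup>2)"
  have w0: "0 \<le> w" using \<theta> pos by (simp add: w_def)
  have "h' * (p * V + m * (\<theta> * \<pi> * p * n * r\<^sup>2)) = h' * p * w"
    by (simp add: w_def algebra_simps)
  also have "\<dots> \<le> (1 + 2 * \<theta>) * h * w"
  proof (rule mult_right_mono[OF _ w0])
    have "h' * p = h' * (p * (1 - \<theta>)) / (1 - \<theta>)" using \<theta> by simp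
    also have "\<dots> \<le> h / (1 - \<theta>)" using h' \<theta> by (intro divide_right_mono) auto
    \<comment> \<open>For \<theta> at most 1/2,
      \<open>1 / (1 - \<theta>) \<le> 1 + 2 * \<theta>\<close>.\<close>
    also have "\<dots> \<le> (1 + 2 * \<theta>) * h"
    proof -
      have "1 \<le> (1 + 2 * \<theta>) * (1 - \<theta>)"
      proof -
        have "0 \<le> \<theta> * (1 - 2 * \<theta>)" using \<theta> by simp
        then show ?thesis by (simp add: algebra_simps)
      qed
      then have "1 * h \<le> (1 + 2 * \<theta>) * (1 - \<theta>) * h" using pos by (intro mult_right_mono)
      then show ?thesis using \<theta> by (simp add: pos_divide_le_eq algebra_simps)
    qed
    finally show "h' * p \<le> (1 + 2 * \<theta>) * h" .
  qed
  also have "\<dots> = h * V + 2 * \<theta> * (h * V) + (1 + 2 * \<theta>) * (\<theta> * m * r\<^sup>2) * (h * (\<pi> * n))"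
    by (simp add: w_def algebra_simps)
  \<comment> \<open>The main term \<open>h * V\<close> is kept; in the error terms it is replaced by
    its crude bound \<open>2 * r\<^sup>2 / \<pi>\<close>, and \<open>1 + 2 * \<theta>\<close> by
    2.\<close>
  also have "\<dots> \<le> h * V + 2 * \<theta> * (2 * (r\<^sup>2 / \<pi>)) + 2 * (\<theta> * m * r\<^sup>2) * 2"
  proof -
    have "h * V \<le> h * (n * r\<^sup>2)" using V pos by (intro mult_left_mono)
    also have "\<dots> = (h * (\<pi> * n)) * (r\<^sup>2 / \<pi>)" using pos by simp
    also have "\<dots> \<le> 2 * (r\<^sup>2 / \<pi>)" using h pos by (intro mult_right_mono) auto
    finally have "h * V \<le> 2 * (r\<^sup>2 / \<pi>)" .
    then have "2 * \<theta> * (h * V) \<le> 2 * \<theta> * (2 * (r\<^sup>2 / \<pi>))" using \<theta> by (intro mult_left_mono) auto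
    moreover have "(1 + 2 * \<theta>) * (\<theta> * m * r\<^sup>2) * (h * (\<pi> * n)) \<le> 2 * (\<theta> * m * r\<^sup>2) * 2"
      using \<theta> pos h by (intro mult_mono[of _ _ "h * (\<pi> * n)"] mult_right_mono) auto
    ultimately show ?thesis by simp
  qed
  also have "\<dots> = h * V + 4 * \<theta> * (1 / \<pi> + m) * r\<^sup>2" by (simp add: algebra_simps)
  also have "\<dots> \<le> h * V + b\<^sup>2" using b by simp
  also have "\<dots> \<le> (sqrt (h * V) + b)\<^sup>2"
    using pos by (simp add: power2_sum)
  finally have "sqrt (h' * (p * V + m * (\<theta> * \<pi> * p * n * r\<^sup>2))) \<le> sqrt (h * V) + b"
    using pos by (intro real_le_lsqrt) auto
  then show ?thesis by simp
qed

lemma partition_restrict: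
  assumes P: "is_partition A k \<Gamma>" and W: "W \<subseteq> A" and ne: "\<And>S. S \<in> \<Gamma> \<Longrightarrow> S \<inter> W \<noteq> {}"
  shows "inj_on (\<lambda>S. S \<inter> W) \<Gamma>" "is_partition W k ((\<lambda>S. S \<inter> W) ` \<Gamma>)"
proof -
  have disj: "S \<inter> T = {}" if "S \<in> \<Gamma>" "T \<in> \<Gamma>" "S \<noteq> T" for S T
    using P that by (auto simp: is_partition_def)
  show inj: "inj_on (\<lambda>S. S \<inter> W) \<Gamma>"
  proof (rule inj_onI, rule ccontr)
    fix S T assume ST: "S \<in> \<Gamma>" "T \<in> \<Gamma>" "S \<inter> W = T \<inter> W" "S \<noteq> T"
    then show False using disj[OF ST(1,2,4)] ne[OF ST(1)] by blast
  qed
  show "is_partition W k ((\<lambda>S. S \<inter> W) ` \<Gamma>)"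
    unfolding is_partition_def
  proof (intro conjI)
    have "\<Union>\<Gamma> = A" using P by (simp add: is_partition_def)
    then show "\<Union>((\<lambda>S. S \<inter> W) ` \<Gamma>) = W" using W by blast
    show "\<forall>S\<in>(\<lambda>S. S \<inter> W) ` \<Gamma>. S \<noteq> {}" using ne by blast
    show "\<forall>S\<in>(\<lambda>S. S \<inter> W) ` \<Gamma>. \<forall>T\<in>(\<lambda>S. S \<inter> W) ` \<Gamma>. S \<noteq> T \<longrightarrow> S \<inter> T = {}"
      using disj by blast
    show "card ((\<lambda>S. S \<inter> W) ` \<Gamma>) = k" using P card_image[OF inj] by (simp add: is_partition_def)
  qed
qed

section \<open>Recovery from the sample\<close>

lemma beta_nonneg: "0 \<le> beta d A X \<Gamma> S T"
  by (simp add: beta_def sum_nonneg)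

lemma closer_if_separation_pos:
  assumes "0 < separation d x a b"
  shows "vnorm d (\<lambda>l. x l - a l) < vnorm d (\<lambda>l. x l - b l)"
proof -
  have "(vnorm d (\<lambda>l. x l - a l))\<^sup>2 < (vnorm d (\<lambda>l. x l - b l))\<^sup>2"
    using assms vnorm_nonneg[of d "\<lambda>l. a l - b l"] by (auto simp: separation_eq zero_less_divide_iff)
  then show ?thesis using vnorm_nonneg by (rule power_less_imp_less_base)
qed

text \<open>Errors are measured against \<open>\<pi> * p * n\<close>, the smallest expected size of
  a sampled cluster. The third bound on \<theta> keeps the loss of separation from the moving
  centroids below half the proximity; the fourth keeps the growth of \<beta> within the other
  half.\<close>

lemma sketch_recovers_if_balanced:
  fixes X :: "nat \<Rightarrow> nat \<Rightarrow> real" and \<Gamma> :: "nat set set" and \<theta> p :: real and d n k :: nat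
  defines "r \<equiv> rad d X \<Gamma>" and "b \<equiv> prox d {1..n} X \<Gamma>" and "\<pi> \<equiv> pi_min n \<Gamma>"
  assumes P: "is_partition {1..n} k \<Gamma>" and k: "0 < k"
    and r: "0 \<le> r" "r \<le> Delta d X \<Gamma> / 2" and b: "0 < b"
    and \<theta>: "0 < \<theta>" "\<theta> \<le> 1/2" "32 * \<theta> * (real d + 1) * r \<le> b"
      "4 * \<theta> * (1 / \<pi> + real k * real d) * r\<^sup>2 \<le> b\<^sup>2"
    and p: "0 < p" and W: "W \<subseteq> {1..n}"
    and size: "\<And>S. S \<in> \<Gamma> \<Longrightarrow> \<bar>real (card (S \<inter> W)) - p * real (card S)\<bar> \<le> \<theta> * \<pi> * p * real n"
    and mean: "\<And>S j. S \<in> \<Gamma> \<Longrightarrow> j < d \<Longrightarrow>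
      \<bar>\<Sum>i\<in>S \<inter> W. X i j - centroid X S j\<bar> \<le> \<theta> * \<pi> * p * real n * r"
    and covar: "\<And>S j l. S \<in> \<Gamma> \<Longrightarrow> j < d \<Longrightarrow> l < d \<Longrightarrow>
      \<bar>(\<Sum>i\<in>S \<inter> W. (X i j - centroid X S j) * (X i l - centroid X S l)) -
        p * (\<Sum>i\<in>S. (X i j - centroid X S j) * (X i l - centroid X S l))\<bar> \<le> \<theta> * \<pi> * p * real n * r\<^sup>2"
  shows "sketch_recovers d n k X \<Gamma> W"
proof -
  have finN: "finite {1..n}" by simp
  note PF = P finN
  note finS = partition_finite(2)[OF PF] and cardS = partition_finite(3)[OF PF]
  have finW: "finite W" using W finite_subset by blast
  have \<pi>: "0 < \<pi>" unfolding \<pi>_def by (rule pi_min_pos[OF P k])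
  have n: "0 < real n" using \<pi> unfolding \<pi>_def pi_min_def by (cases "n = 0") auto
  define e where "e = \<theta> * \<pi> * p * real n"
  define c where "c S = centroid X (S \<inter> W)" for S
  define V where "V S = (opnorm d {1..n} X S)\<^sup>2" for S
  \<comment> \<open>The rate \<open>p\<close> times the squared norm of the full cluster, plus the
    spectral effect of an entrywise error \<open>e * r\<^sup>2\<close>.\<close>
  define KS where "KS S = p * V S + real d * (e * r\<^sup>2)" for S
  have e0: "0 \<le> e" using \<theta> \<pi> p n by (simp add: e_def)
  have pin: "\<pi> * real n \<le> real (card S)" if "S \<in> \<Gamma>" for S
    unfolding \<pi>_def by (rule pi_min_le[OF P that])
  have sz: "(1 - \<theta>) * p * real (card S) \<le> real (card (S \<inter> W))" if "S \<in> \<Gamma>" for S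
  proof -
    have "e = \<theta> * p * (\<pi> * real n)" by (simp add: e_def)
    also have "\<dots> \<le> \<theta> * p * real (card S)" using pin[OF that] \<theta> p by (intro mult_left_mono) auto
    finally show ?thesis using size[OF that] unfolding e_def[symmetric] by (simp add: algebra_simps abs_le_iff)
  qed
  have sz0: "0 < card (S \<inter> W)" if "S \<in> \<Gamma>" for S
  proof -
    have "0 < (1 - \<theta>) * p * real (card S)" using \<theta> p cardS[OF that] by simp
    then show ?thesis using sz[OF that] by linarith
  qed
  then have ne: "S \<inter> W \<noteq> {}" if "S \<in> \<Gamma>" for S using that by fastforce
  have inj: "inj_on (\<lambda>S. S \<inter> W) \<Gamma>" and PW: "is_partition W k ((\<lambda>S. S \<inter> W) ` \<Gamma>)"
    using partition_restrict[OF P W] ne by blast+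
  let ?\<Gamma> = "(\<lambda>S. S \<inter> W) ` \<Gamma>"
  have u_le: "vnorm d (\<lambda>j. X i j - centroid X S j) \<le> r" if "S \<in> \<Gamma>" "i \<in> S" for S i
    unfolding r_def by (rule le_rad[OF PF that])
  have SN: "S \<subseteq> {1..n}" if "S \<in> \<Gamma>" for S by (rule partition_subset[OF P that])

  \<comment> \<open>Every coordinate of a centroid moves by at most \<open>2 * \<theta> * r\<close>,
    and the Euclidean norm is at most the sum over the \<open>d\<close> coordinates.\<close>
  define \<delta> where "\<delta> = real d * (2 * \<theta> * r)"
  have shift: "vnorm d (\<lambda>l. c S l - centroid X S l) \<le> \<delta>" if S: "S \<in> \<Gamma>" for S
  proof -
    have "\<bar>c S j - centroid X S j\<bar> \<le> 2 * \<theta> * r" if j: "j < d" for j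
    proof -
      let ?m = "real (card (S \<inter> W))"
      have m: "0 < ?m" using sz0[OF S] by simp
      have "c S j - centroid X S j = (\<Sum>i\<in>S \<inter> W. X i j - centroid X S j) / ?m"
        using m by (simp add: c_def centroid_def[of X "S \<inter> W"] sum_subtractf diff_divide_distrib)
      then have "\<bar>c S j - centroid X S j\<bar> = \<bar>\<Sum>i\<in>S \<inter> W. X i j - centroid X S j\<bar> / ?m"
        using m by simp
      also have "\<dots> \<le> (e * r) / ?m" using mean[OF S j] m by (simp add: e_def divide_right_mono)
      \<comment> \<open>As \<theta> is at most 1/2, the sampled cluster has at least half of its
        expected size.\<close>
      also have "\<dots> \<le> 2 * \<theta> * r"
      proof -
        have "p * (\<pi> * real n) \<le> p * real (card S)" using pin[OF S] p by simp
        also have "\<dots> = 2 * (1/2 * (p * real (card S)))" by simp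
        also have "\<dots> \<le> 2 * ((1 - \<theta>) * (p * real (card S)))"
          using \<theta> p by (intro mult_left_mono mult_right_mono) auto
        also have "\<dots> \<le> 2 * ?m" using sz[OF S] by (simp add: mult.assoc)
        finally have "\<theta> * r * (p * (\<pi> * real n)) \<le> \<theta> * r * (2 * ?m)"
          using \<theta> r by (intro mult_left_mono) auto
        then have "e * r \<le> 2 * \<theta> * r * ?m" by (simp add: e_def mult_ac)
        then show ?thesis using m by (simp add: pos_divide_le_eq)
      qed
      finally show ?thesis .
    qed
    then have "(\<Sum>j<d. \<bar>c S j - centroid X S j\<bar>) \<le> (\<Sum>j<d. 2 * \<theta> * r)" by (intro sum_mono) auto
    then show ?thesis
      using L2_set_le_sum_abs[of "\<lambda>l. c S l - centroid X S l" "{..<d}"]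
      by (simp add: \<delta>_def vnorm_eq_L2_set)
  qed
  have \<delta>4: "4 * \<delta> < b / 2"
  proof -
    have "4 * \<delta> = 8 * \<theta> * real d * r" by (simp add: \<delta>_def)
    also have "\<dots> \<le> 8 * \<theta> * (real d + 1) * r" using \<theta> r by (intro mult_right_mono mult_left_mono) auto
    finally show ?thesis using \<theta>(3) b by linarith
  qed
  \<comment> \<open>One half of the proximity covers the shift of the centroids; the other half is
    left for the comparison of the sampled threshold with \<open>beta\<close> in
    \<open>betaW\<close>.\<close>
  have sep: "beta d {1..n} X \<Gamma> S T + b / 2 < separation d (X i) (c S) (c T)"
    if ST: "S \<in> \<Gamma>" "T \<in> \<Gamma>" "S \<noteq> T" "i \<in> S" for S T i
  proof -
    let ?g = "separation d (X i) (centroid X S) (centroid X T)"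
    have g: "beta d {1..n} X \<Gamma> S T + b \<le> ?g"
      unfolding b_def by (rule beta_add_prox_le_separation[OF PF ST])
    have gb: "b \<le> ?g" using g beta_nonneg[of d "{1..n}" X \<Gamma> S T] by linarith
    have "?g - 4 * \<delta> \<le> separation d (X i) (c S) (c T)"
    proof (rule separation_perturb[OF u_le[OF ST(1,4)] _ shift[OF ST(1)] shift[OF ST(2)]])
      show "2 * r \<le> vnorm d (\<lambda>l. centroid X S l - centroid X T l)"
        using Delta_le[OF PF ST(1-3), of d X] r by simp
    qed (use gb b \<delta>4 in linarith)+
    then show ?thesis using g \<delta>4 by linarith
  qed
  have closer: "vnorm d (\<lambda>j. X i j - c S j) < vnorm d (\<lambda>j. X i j - c T j)"
    if ST: "S \<in> \<Gamma>" "T \<in> \<Gamma>" "S \<noteq> T" "i \<in> S" for S T i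
    by (rule closer_if_separation_pos)
      (use sep[OF ST] beta_nonneg[of d "{1..n}" X \<Gamma> S T] b in linarith)

  have V0: "0 \<le> V S" for S by (simp add: V_def)
  have cov: "(\<Sum>i\<in>S \<inter> W. (vinner d y (\<lambda>l. X i l - centroid X (S \<inter> W) l))\<^sup>2) \<le> KS S * vinner d y y"
    if S: "S \<in> \<Gamma>" for S y
  proof -
    let ?u = "\<lambda>i l. X i l - centroid X S l"
    have "(\<Sum>i\<in>S \<inter> W. (vinner d y (\<lambda>l. X i l - centroid X (S \<inter> W) l))\<^sup>2) \<le> (\<Sum>i\<in>S \<inter> W. (vinner d y (?u i))\<^sup>2)"
      by (rule centered_covariance_le) (use finW in simp)
    also have "\<dots> = p * (\<Sum>i\<in>S. (vinner d y (?u i))\<^sup>2) + (\<Sum>j<d. \<Sum>l<d. y j * y l *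
        ((\<Sum>i\<in>S \<inter> W. ?u i j * ?u i l) - p * (\<Sum>i\<in>S. ?u i j * ?u i l)))"
      unfolding covariance_expand sum_distrib_left[of p] sum.distrib[symmetric]
      by (intro sum.cong refl) (simp add: right_diff_distrib sum_distrib_left mult_ac)
    also have "\<dots> \<le> p * (V S * vinner d y y) + real d * (e * r\<^sup>2) * vinner d y y"
    proof (intro add_mono mult_left_mono)
      show "(\<Sum>i\<in>S. (vinner d y (?u i))\<^sup>2) \<le> V S * vinner d y y"
        unfolding V_def by (rule covariance_le_opnorm[OF finN SN[OF S] u_le[OF S]])
      show "(\<Sum>j<d. \<Sum>l<d. y j * y l *
        ((\<Sum>i\<in>S \<inter> W. ?u i j * ?u i l) - p * (\<Sum>i\<in>S. ?u i j * ?u i l))) \<le> real d * (e * r\<^sup>2) * vinner d y y"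
        by (rule quadratic_form_le) (use covar[OF S] in \<open>simp add: e_def\<close>)
    qed (use p in simp)
    also have "\<dots> = KS S * vinner d y y" by (simp add: KS_def algebra_simps)
    finally show ?thesis .
  qed
  have sumV: "(\<Sum>S\<in>\<Gamma>. V S) \<le> real n * r\<^sup>2"
  proof -
    have "(\<Sum>S\<in>\<Gamma>. V S) \<le> (\<Sum>S\<in>\<Gamma>. real (card S) * r\<^sup>2)"
      unfolding V_def by (intro sum_mono opnorm_squared_le[OF finN SN u_le])
    also have "\<dots> = (\<Sum>S\<in>\<Gamma>. \<Sum>i\<in>S. 1) * r\<^sup>2" by (simp add: sum_distrib_right)
    also have "(\<Sum>S\<in>\<Gamma>. \<Sum>i\<in>S. (1::real)) = real n"
      using sum_partition[OF PF, of "\<lambda>_. 1::real"] by simp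
    finally show ?thesis .
  qed
  have sumK: "(\<Sum>S\<in>\<Gamma>. KS S) = p * (\<Sum>S\<in>\<Gamma>. V S) + (real k * real d) * (\<theta> * \<pi> * p * real n * r\<^sup>2)"
    using P by (simp add: KS_def sum.distrib sum_distrib_left is_partition_def e_def mult_ac)
  have betaW: "1/2 * sqrt ((1 / real (card (S \<inter> W)) + 1 / real (card (T \<inter> W))) * (\<Sum>R\<in>\<Gamma>. KS R)) \<le>
      beta d {1..n} X \<Gamma> S T + b / 2" if ST: "S \<in> \<Gamma>" "T \<in> \<Gamma>" for S T
    unfolding sumK beta_def V_def[symmetric]
  proof (rule beta_perturb[OF \<theta>(1,2) p \<pi> n])
    have "1 / real (card (S \<inter> W)) * (p * (1 - \<theta>)) \<le> 1 / real (card S)" if "S \<in> \<Gamma>" for S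
      using sz[OF that] sz0[OF that] cardS[OF that] by (simp add: field_simps)
    from this[OF ST(1)] this[OF ST(2)]
    show "(1 / real (card (S \<inter> W)) + 1 / real (card (T \<inter> W))) * (p * (1 - \<theta>)) \<le> 1 / real (card S) + 1 / real (card T)"
      unfolding distrib_right by (rule add_mono)
    have "1 / real (card S) * (\<pi> * real n) \<le> 1" if "S \<in> \<Gamma>" for S
      using pin[OF that] cardS[OF that] by simp
    from this[OF ST(1)] this[OF ST(2)]
    show "(1 / real (card S) + 1 / real (card T)) * (\<pi> * real n) \<le> 2"
      unfolding distrib_right by linarith
  qed (use sumV \<theta>(4) b V0 in \<open>auto intro: sum_nonneg\<close>)
  have min: "pw_unique_minimizer d X W k (Zmat ?\<Gamma>)"
  \<comment> \<open>The bounds \<open>KS\<close> belong to the original clusters; the inverse of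
    \<open>S \<mapsto> S \<inter> W\<close> transfers them to the sampled ones.\<close>
  proof (rule peng_wei_unique_minimizer[OF PW finW, where K="\<lambda>S'. KS (the_inv_into \<Gamma> (\<lambda>S. S \<inter> W) S')"])
    have inv: "the_inv_into \<Gamma> (\<lambda>S. S \<inter> W) (S \<inter> W) = S" if "S \<in> \<Gamma>" for S
      by (rule the_inv_into_f_f[OF inj that])
    show "0 \<le> KS (the_inv_into \<Gamma> (\<lambda>S. S \<inter> W) S')" for S'
      using p e0 V0 by (simp add: KS_def)
    fix S' assume "S' \<in> ?\<Gamma>"
    then obtain S where S: "S \<in> \<Gamma>" "S' = S \<inter> W" by blast
    show "(\<Sum>i\<in>S'. (vinner d y (\<lambda>l. X i l - centroid X S' l))\<^sup>2) \<le> KS (the_inv_into \<Gamma> (\<lambda>S. S \<inter> W) S') * vinner d y y" for y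
      unfolding S(2) inv[OF S(1)] by (rule cov[OF S(1)])
    fix T' i assume "T' \<in> ?\<Gamma>" and ne': "S' \<noteq> T'" and i: "i \<in> S'"
    then obtain T where T: "T \<in> \<Gamma>" "T' = T \<inter> W" by blast
    have "(\<Sum>R\<in>?\<Gamma>. KS (the_inv_into \<Gamma> (\<lambda>S. S \<inter> W) R)) = (\<Sum>R\<in>\<Gamma>. KS R)"
      by (rule sum.reindex_cong[OF inj refl]) (simp add: inv)
    moreover have "S \<noteq> T" "i \<in> S" using ne' i S T by auto
    ultimately show "1/2 * sqrt ((1 / real (card S') + 1 / real (card T')) * (\<Sum>R\<in>?\<Gamma>. KS (the_inv_into \<Gamma> (\<lambda>S. S \<inter> W) R)))
        < vinner d (\<lambda>l. X i l - (centroid X S' l + centroid X T' l) / 2)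
          (\<lambda>l. (centroid X S' l - centroid X T' l) / vnorm d (\<lambda>l. centroid X S' l - centroid X T' l))"
      using betaW[OF S(1) T(1)] sep[OF S(1) T(1), of i] unfolding S(2) T(2) separation_def c_def by simp
  qed
  have asg: "assigned d n X ?\<Gamma> (S \<inter> W) = S" if S: "S \<in> \<Gamma>" for S
  proof
    show "S \<subseteq> assigned d n X ?\<Gamma> (S \<inter> W)"
      unfolding assigned_def using SN[OF S] closer[OF S] by (auto simp: c_def)
    show "assigned d n X ?\<Gamma> (S \<inter> W) \<subseteq> S"
    proof
      fix i assume i: "i \<in> assigned d n X ?\<Gamma> (S \<inter> W)"
      then have "i \<in> {1..n}" by (simp add: assigned_def)
      note T = cluster_in[OF P this]
      show "i \<in> S"
      proof (rule ccontr)
        assume "i \<notin> S"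
        then have TS: "cluster \<Gamma> i \<noteq> S" using T by auto
        then have "cluster \<Gamma> i \<inter> W \<noteq> S \<inter> W" using inj T(1) S by (auto dest: inj_onD)
        then have "vnorm d (\<lambda>j. X i j - c S j) < vnorm d (\<lambda>j. X i j - c (cluster \<Gamma> i) j)"
          using i T(1) by (simp add: assigned_def c_def)
        then show False using closer[OF T(1) S TS T(2)] by simp
      qed
    qed
  qed
  show ?thesis
    unfolding sketch_recovers_def
  proof (intro exI[of _ ?\<Gamma>] conjI PW min ballI)
    fix i assume "i \<in> {1..n}"
    note T = cluster_in[OF P this]
    show "\<exists>S'\<in>?\<Gamma>. i \<in> assigned d n X ?\<Gamma> S'"
      using T asg[OF T(1)] by blast
  next
    show "assigned d n X ?\<Gamma> ` ?\<Gamma> = \<Gamma>"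
      unfolding image_image using asg by simp
  qed
qed

section \<open>The explicit constant, its monotonicity, and the probability of recovery\<close>

lemma union_bound_le:
  fixes \<epsilon> M x :: real
  assumes "0 < \<epsilon>" "\<epsilon> < 1/2" "0 \<le> M" "(1 + 2 * M) * ln (1 / \<epsilon>) \<le> x"
  shows "M * exp (- x) \<le> \<epsilon>"
proof -
  let ?L = "ln (1 / \<epsilon>)"
  \<comment> \<open>The logarithm is at least 1/2, so the term \<open>2 * M * ?L\<close> pays for an
    extra \<open>M\<close> in the exponent, and \<open>M * exp (- M) \<le> 1\<close> absorbs the
    prefactor.\<close>
  have "ln 2 \<le> ?L" using assms by (subst ln_le_cancel_iff) (auto simp: field_simps)
  then have "1/2 \<le> ?L" using ln2_ge_two_thirds by linarith
  then have "M * (1/2) \<le> M * ?L" using assms(3) by (intro mult_left_mono)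
  then have "M + ?L \<le> x" using assms(4) by (simp add: distrib_right)
  then have "M * exp (- x) \<le> M * exp (- M - ?L)" using assms(3) by (intro mult_left_mono) auto
  also have "\<dots> = M * exp (- M) * \<epsilon>" using assms(1) by (simp add: exp_diff exp_minus ln_div field_simps)
  also have "\<dots> \<le> 1 * \<epsilon>"
  proof (rule mult_right_mono)
    have "M \<le> exp M" using exp_ge_add_one_self[of M] by linarith
    then show "M * exp (- M) \<le> 1" by (simp add: exp_minus field_simps)
  qed (use assms in simp)
  finally show ?thesis by simp
qed

text \<open>The largest \<theta> allowed in the deterministic recovery, with \<open>b\<close>
  standing for the proximity divided by the radius: the three terms serve the sample sizes, the
  shift of the centroids and the growth of \<beta>.\<close>

definition sample_tol :: "nat \<Rightarrow> real \<Rightarrow> nat \<Rightarrow> real \<Rightarrow> real" where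
  "sample_tol d b k \<pi> =
    min (1/2) (min (b / (32 * (real d + 1))) (b\<^sup>2 / (4 * (1 / \<pi> + real k * real d))))"

text \<open>There are \<open>k (d + 1)\<^sup>2\<close> monitored sums, each with two tails, so
  \<open>1 + 2 M\<close> with \<open>M = 2 k (d + 1)\<^sup>2\<close> comes from the union bound. The
  rest inverts the exponent \<open>\<eta>\<^sup>2 p n / 4\<close> at
  \<open>\<eta> = \<pi> \<theta>\<close>.\<close>

definition shape_const :: "nat \<Rightarrow> real \<Rightarrow> nat \<Rightarrow> real \<Rightarrow> real" where
  "shape_const d b k \<pi> =
    4 * (1 + 2 * (2 * real (k * (d + 1)\<^sup>2))) / (\<pi> * sample_tol d b k \<pi>)\<^sup>2"

lemma sample_tol_pos:
  assumes "0 < b" "0 < \<pi>"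
  shows "0 < sample_tol d b k \<pi>"
proof -
  have "0 < 1 / \<pi> + real k * real d" using assms by (intro add_pos_nonneg) auto
  then show ?thesis using assms by (simp add: sample_tol_def)
qed

lemma sample_tol_antimono:
  assumes "d \<le> d'" "b' \<le> b" "k \<le> k'" "\<pi>' \<le> \<pi>" "0 < b'" "0 < \<pi>'"
  shows "sample_tol d' b' k' \<pi>' \<le> sample_tol d b k \<pi>"
  unfolding sample_tol_def
proof (intro min.mono order_refl frac_le power_mono mult_left_mono add_mono mult_mono)
  have "0 < 1 / \<pi> + real k * real d" using assms by (intro add_pos_nonneg) auto
  then show "0 < 4 * (1 / \<pi> + real k * real d)" by simp
qed (use assms in auto)

lemma shape_const_mono:
  assumes "d \<le> d'" "b' \<le> b" "k \<le> k'" "\<pi>' \<le> \<pi>" "0 < b'" "0 < \<pi>'"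
  shows "shape_const d b k \<pi> \<le> shape_const d' b' k' \<pi>'"
  unfolding shape_const_def
proof (rule frac_le)
  have t: "0 < sample_tol d' b' k' \<pi>'" using sample_tol_pos assms by blast
  have "k * (d + 1)\<^sup>2 \<le> k' * (d' + 1)\<^sup>2" using assms by (intro mult_mono power_mono) auto
  then have "real (k * (d + 1)\<^sup>2) \<le> real (k' * (d' + 1)\<^sup>2)" by (rule of_nat_mono)
  then show "4 * (1 + 2 * (2 * real (k * (d + 1)\<^sup>2))) \<le> 4 * (1 + 2 * (2 * real (k' * (d' + 1)\<^sup>2)))"
    by (intro mult_left_mono add_left_mono) simp_all
  show "0 < (\<pi>' * sample_tol d' b' k' \<pi>')\<^sup>2" using t assms by simp
  show "(\<pi>' * sample_tol d' b' k' \<pi>')\<^sup>2 \<le> (\<pi> * sample_tol d b k \<pi>)\<^sup>2"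
    using t assms sample_tol_antimono[OF assms] by (intro power_mono mult_mono) auto
qed simp

text \<open>After division by the radius all monitored quantities are bounded by 1, so one
  concentration event covers them, and on it the deterministic recovery applies with \<theta> equal
  to \<open>sample_tol\<close>.\<close>

lemma sketch_recovers_probability:
  fixes X :: "nat \<Rightarrow> nat \<Rightarrow> real" and \<Gamma> :: "nat set set" and d n k :: nat and p \<epsilon> :: real
  defines "r \<equiv> rad d X \<Gamma>" and "b \<equiv> prox d {1..n} X \<Gamma>" and "\<pi> \<equiv> pi_min n \<Gamma>"
  assumes P: "is_partition {1..n} k \<Gamma>" and k: "0 < k"
    and r: "0 < r" "r \<le> Delta d X \<Gamma> / 2" and b: "0 < b"
    and \<epsilon>: "0 < \<epsilon>" "\<epsilon> < 1/2" and p: "0 < p" "p \<le> 1"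
    and pn: "shape_const d (b / r) k \<pi> * ln (1 / \<epsilon>) \<le> p * real n"
  shows "1 - \<epsilon> \<le> measure_pmf.prob (bernoulli_sample n p) {W. sketch_recovers d n k X \<Gamma> W}"
proof -
  have finN: "finite {1..n}" by simp
  note PF = P finN
  define \<theta> where "\<theta> = sample_tol d (b / r) k \<pi>"
  define \<eta> where "\<eta> = \<theta> * \<pi>"
  have \<pi>: "0 < \<pi>" unfolding \<pi>_def by (rule pi_min_pos[OF P k])
  have n: "0 < real n" using \<pi> unfolding \<pi>_def pi_min_def by (cases "n = 0") auto
  have \<pi>1: "\<pi> \<le> 1"
  proof -
    obtain S where S: "S \<in> \<Gamma>" using P k by (fastforce simp: is_partition_def)
    have "card S \<le> n" using card_mono[OF finN partition_subset[OF P S]] by simp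
    then have "\<pi> * real n \<le> 1 * real n" using pi_min_le[OF P S] by (simp add: \<pi>_def)
    then show ?thesis using n by simp
  qed
  have \<theta>0: "0 < \<theta>" unfolding \<theta>_def using b r \<pi> by (intro sample_tol_pos) auto
  have \<theta>1: "\<theta> \<le> 1/2" unfolding \<theta>_def sample_tol_def by (rule min.cobounded1)
  have \<theta>2: "32 * \<theta> * (real d + 1) * r \<le> b"
  proof -
    have "\<theta> \<le> (b / r) / (32 * (real d + 1))"
      unfolding \<theta>_def sample_tol_def by (rule order_trans[OF min.cobounded2 min.cobounded1])
    then have "\<theta> * (r * (32 * (real d + 1))) \<le> b"
      unfolding divide_divide_eq_left using r by (subst (asm) pos_le_divide_eq) auto
    then show ?thesis by (simp add: mult_ac)
  qed
  have \<theta>3: "4 * \<theta> * (1 / \<pi> + real k * real d) * r\<^sup>2 \<le> b\<^sup>2"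
  proof -
    define s where "s = 1 / \<pi> + real k * real d"
    have s: "0 < s" using \<pi> unfolding s_def by (intro add_pos_nonneg) auto
    have "\<theta> \<le> (b / r)\<^sup>2 / (4 * s)"
      unfolding \<theta>_def sample_tol_def s_def by (rule order_trans[OF min.cobounded2 min.cobounded2])
    then show ?thesis using r s unfolding s_def[symmetric] by (simp add: field_simps power_divide)
  qed
  have \<eta>: "0 < \<eta>" "\<eta> \<le> 2"
    using \<theta>0 \<pi> mult_mono[OF \<theta>1 \<pi>1] by (simp_all add: \<eta>_def)

  text \<open>The index \<open>j = d\<close> stands for the constant 1, so that one family of second moments
    covers the sizes, the means and the covariances of the sampled clusters.\<close>
  define \<phi> where "\<phi> S j i = (if j < d then (X i j - centroid X S j) / r else 1)" for S j i
  \<comment> \<open>Extension by 0 turns sums over a cluster into sums over all of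
    \<open>{1..n}\<close>, where the deviation bound applies.\<close>
  define y where "y = (\<lambda>(S, j, l) i. if i \<in> S then \<phi> S j i * \<phi> S l i else 0)"
  let ?I = "\<Gamma> \<times> {..d} \<times> {..d}"
  have \<phi>1: "\<bar>\<phi> S j i\<bar> \<le> 1" if "S \<in> \<Gamma>" "i \<in> S" for S j i
  proof -
    have "\<bar>X i j - centroid X S j\<bar> \<le> r" if "j < d"
      using abs_component_le_vnorm[OF that, of "\<lambda>j. X i j - centroid X S j"]
        le_rad[OF PF \<open>S \<in> \<Gamma>\<close> \<open>i \<in> S\<close>, of d X] by (simp add: r_def)
    then show ?thesis using r by (simp add: \<phi>_def)
  qed
  have y1: "\<bar>y c i\<bar> \<le> 1" if cI: "c \<in> ?I" for c i
  proof -
    obtain S j l where c: "c = (S, j, l)" "S \<in> \<Gamma>" using cI by blast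
    have "\<bar>\<phi> S j i\<bar> * \<bar>\<phi> S l i\<bar> \<le> 1 * 1" if "i \<in> S"
      by (intro mult_mono \<phi>1 c that) auto
    then show ?thesis by (simp add: y_def c abs_mult)
  qed
  have finI: "finite ?I" using partition_finite(1)[OF PF] by simp
  let ?G = "{W. W \<subseteq> {1..n} \<and> (\<forall>c\<in>?I. \<bar>(\<Sum>i\<in>W. y c i) - p * (\<Sum>i\<in>{1..n}. y c i)\<bar> \<le> \<eta> * p * real n)}"
  have "?G \<subseteq> {W. sketch_recovers d n k X \<Gamma> W}"
  proof
    fix W assume "W \<in> ?G"
    then have W: "W \<subseteq> {1..n}"
      and dev: "\<And>c. c \<in> ?I \<Longrightarrow> \<bar>(\<Sum>i\<in>W. y c i) - p * (\<Sum>i\<in>{1..n}. y c i)\<bar> \<le> \<eta> * p * real n"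
      by auto
    have finW: "finite W" using W finite_subset by blast
    have dev': "\<bar>(\<Sum>i\<in>S \<inter> W. \<phi> S j i * \<phi> S l i) - p * (\<Sum>i\<in>S. \<phi> S j i * \<phi> S l i)\<bar> \<le> \<eta> * p * real n"
      if "S \<in> \<Gamma>" "j \<le> d" "l \<le> d" for S j l
    proof -
      have "(\<Sum>i\<in>W. y (S, j, l) i) = (\<Sum>i\<in>S \<inter> W. \<phi> S j i * \<phi> S l i)"
        unfolding y_def Int_commute[of S W] using finW by (simp add: sum.inter_restrict)
      moreover have "(\<Sum>i\<in>{1..n}. y (S, j, l) i) = (\<Sum>i\<in>{1..n} \<inter> S. \<phi> S j i * \<phi> S l i)"
        unfolding y_def by (simp add: sum.inter_restrict)
      moreover have "{1..n} \<inter> S = S" using partition_subset[OF P that(1)] by blast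
      ultimately show ?thesis using dev[of "(S, j, l)"] that by simp
    qed
    show "W \<in> {W. sketch_recovers d n k X \<Gamma> W}"
    proof (rule CollectI, rule sketch_recovers_if_balanced[OF P k, where \<theta>=\<theta> and p=p])
      fix S assume S: "S \<in> \<Gamma>"
      show "\<bar>real (card (S \<inter> W)) - p * real (card S)\<bar> \<le> \<theta> * pi_min n \<Gamma> * p * real n"
        using dev'[OF S, of d d] by (simp add: \<phi>_def \<eta>_def \<pi>_def)
      fix j assume j: "j < d"
      let ?u = "\<lambda>i j. X i j - centroid X S j"
      have "S \<noteq> {}" using P S by (auto simp: is_partition_def)
      \<comment> \<open>Centred coordinates sum to 0 over the full cluster, so their deviation is
        the sampled sum itself.\<close>
      then have 0: "(\<Sum>i\<in>S. ?u i j) = 0" using sum_centered[OF partition_finite(2)[OF PF S]] by blast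
      have "\<bar>(\<Sum>i\<in>S \<inter> W. ?u i j) / r - p * ((\<Sum>i\<in>S. ?u i j) / r)\<bar> \<le> \<eta> * p * real n"
        using dev'[OF S, of j d] j by (simp add: \<phi>_def sum_divide_distrib)
      then show "\<bar>\<Sum>i\<in>S \<inter> W. ?u i j\<bar> \<le> \<theta> * pi_min n \<Gamma> * p * real n * rad d X \<Gamma>"
        unfolding 0 \<pi>_def[symmetric] r_def[symmetric] \<eta>_def[symmetric] using r by (simp add: field_simps)
      fix l assume l: "l < d"
      have "\<bar>(\<Sum>i\<in>S \<inter> W. ?u i j * ?u i l) / r\<^sup>2 - p * ((\<Sum>i\<in>S. ?u i j * ?u i l) / r\<^sup>2)\<bar> \<le> \<eta> * p * real n"
        using dev'[OF S, of j l] j l by (simp add: \<phi>_def sum_divide_distrib power2_eq_square)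
      moreover have "a / r\<^sup>2 - p * (c / r\<^sup>2) = (a - p * c) / r\<^sup>2" for a c
        by (simp add: diff_divide_distrib)
      ultimately show "\<bar>(\<Sum>i\<in>S \<inter> W. ?u i j * ?u i l) - p * (\<Sum>i\<in>S. ?u i j * ?u i l)\<bar>
          \<le> \<theta> * pi_min n \<Gamma> * p * real n * (rad d X \<Gamma>)\<^sup>2"
        unfolding \<pi>_def[symmetric] r_def[symmetric] \<eta>_def[symmetric] using r
        by (simp add: pos_divide_le_eq)
    qed (use r b \<theta>0 \<theta>1 \<theta>2 \<theta>3 p W in \<open>simp_all add: r_def b_def \<pi>_def\<close>)
  qed
  then have "measure_pmf.prob (bernoulli_sample n p) ?G \<le>
      measure_pmf.prob (bernoulli_sample n p) {W. sketch_recovers d n k X \<Gamma> W}"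
    by (intro measure_pmf.finite_measure_mono) auto
  moreover have "1 - 2 * real (card ?I) * exp (- (\<eta>\<^sup>2 * p * real n / 4)) \<le> measure_pmf.prob (bernoulli_sample n p) ?G"
    by (rule bernoulli_sample_deviation[OF finI y1]) (use p \<eta> in auto)
  moreover have "2 * real (card ?I) * exp (- (\<eta>\<^sup>2 * p * real n / 4)) \<le> \<epsilon>"
  proof (rule union_bound_le[OF \<epsilon>])
    have "card ?I = k * (d + 1)\<^sup>2"
      using P by (simp add: card_cartesian_product is_partition_def power2_eq_square)
    then have "shape_const d (b / r) k \<pi> = 4 * (1 + 2 * (2 * real (card ?I))) / \<eta>\<^sup>2"
      by (simp add: shape_const_def \<eta>_def \<theta>_def mult.commute)
    with pn have "4 * (1 + 2 * (2 * real (card ?I))) / \<eta>\<^sup>2 * ln (1 / \<epsilon>) \<le> p * real n" by simp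
    then have "4 * (1 + 2 * (2 * real (card ?I))) * ln (1 / \<epsilon>) \<le> p * real n * \<eta>\<^sup>2"
      using \<eta> by (simp add: pos_divide_le_eq del: ln_div)
    then show "(1 + 2 * (2 * real (card ?I))) * ln (1 / \<epsilon>) \<le> \<eta>\<^sup>2 * p * real n / 4"
      by (simp add: algebra_simps)
  qed simp
  ultimately show ?thesis by linarith
qed

text \<open>The shape parameter is a single function \<open>F\<close>, fixed before the data and
  evaluated at the six quantities. A positive radius gives the quotients by it their
  meaning.\<close>

theorem theorem2:
  "\<exists>F :: nat \<Rightarrow> real \<Rightarrow> real \<Rightarrow> nat \<Rightarrow> real \<Rightarrow> real \<Rightarrow> ennreal.
     (\<forall>d d' a a' b b' k k' pmn pmn' pmx pmx'.
        d \<le> d' \<and> a' \<le> a \<and> b' \<le> b \<and> k \<le> k' \<and> pmn' \<le> pmn \<and> pmx \<le> pmx' \<longrightarrow>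
        F d a b k pmn pmx \<le> F d' a' b' k' pmn' pmx') \<and>
     (\<forall>d n k (X :: nat \<Rightarrow> nat \<Rightarrow> real) \<Gamma>.
        1 \<le> d \<longrightarrow> 2 \<le> k \<longrightarrow> k \<le> n \<longrightarrow> is_partition {1..n} k \<Gamma> \<longrightarrow>
        0 < rad d X \<Gamma> \<longrightarrow> 0 < prox d {1..n} X \<Gamma> \<longrightarrow> rad d X \<Gamma> \<le> Delta d X \<Gamma> / 2 \<longrightarrow>
        (let C = F d (Delta d X \<Gamma> / rad d X \<Gamma>) (prox d {1..n} X \<Gamma> / rad d X \<Gamma>) k
                   (pi_min n \<Gamma>) (pi_max n \<Gamma>)
         in C < \<infinity> \<and>
            (\<forall>\<epsilon> p. 0 < \<epsilon> \<and> \<epsilon> < 1/2 \<and> 0 < p \<and> p \<le> 1 \<and>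
                C * ennreal (ln (1 / \<epsilon>)) < ennreal (p * real n) \<longrightarrow>
                measure_pmf.prob (bernoulli_sample n p) {W. sketch_recovers d n k X \<Gamma> W}
                  \<ge> 1 - \<epsilon>)))"
proof -
  \<comment> \<open>Monotonicity is claimed for all real arguments, so \<open>F\<close> is infinite
    where \<open>b\<close> or \<pi> is not positive; on admissible data both are positive and the
    value is finite.\<close>
  define F :: "nat \<Rightarrow> real \<Rightarrow> real \<Rightarrow> nat \<Rightarrow> real \<Rightarrow> real \<Rightarrow> ennreal" where
    "F d a b k \<pi> \<pi>' = (if 0 < b \<and> 0 < \<pi> then ennreal (shape_const d b k \<pi>) else \<infinity>)" for d a b k \<pi> \<pi>'
  have mono: "F d a b k \<pi> \<sigma> \<le> F d' a' b' k' \<pi>' \<sigma>'"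
    if "d \<le> d'" "b' \<le> b" "k \<le> k'" "\<pi>' \<le> \<pi>" for d d' a a' b b' k k' \<pi> \<pi>' \<sigma> \<sigma>'
  proof (cases "0 < b' \<and> 0 < \<pi>'")
    case True
    then have "shape_const d b k \<pi> \<le> shape_const d' b' k' \<pi>'"
      using that by (intro shape_const_mono) auto
    then show ?thesis using True that by (auto simp: F_def intro: ennreal_leI)
  qed (auto simp: F_def)
  have main: "F d a (prox d {1..n} X \<Gamma> / rad d X \<Gamma>) k (pi_min n \<Gamma>) s < \<infinity> \<and>
      (\<forall>\<epsilon> p. 0 < \<epsilon> \<and> \<epsilon> < 1/2 \<and> 0 < p \<and> p \<le> 1 \<and>
        F d a (prox d {1..n} X \<Gamma> / rad d X \<Gamma>) k (pi_min n \<Gamma>) s * ennreal (ln (1 / \<epsilon>)) < ennreal (p * real n) \<longrightarrow>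
        1 - \<epsilon> \<le> measure_pmf.prob (bernoulli_sample n p) {W. sketch_recovers d n k X \<Gamma> W})"
    if H: "2 \<le> k" "is_partition {1..n} k \<Gamma>" "0 < rad d X \<Gamma>" "0 < prox d {1..n} X \<Gamma>"
      "rad d X \<Gamma> \<le> Delta d X \<Gamma> / 2" for d n k X \<Gamma> a s
  proof -
    have k: "0 < k" using H by simp
    let ?C = "shape_const d (prox d {1..n} X \<Gamma> / rad d X \<Gamma>) k (pi_min n \<Gamma>)"
    have F: "F d a (prox d {1..n} X \<Gamma> / rad d X \<Gamma>) k (pi_min n \<Gamma>) s = ennreal ?C"
      using H pi_min_pos[OF H(2) k] by (simp add: F_def)
    have C0: "0 \<le> ?C" by (simp add: shape_const_def)
    show ?thesis
      unfolding F
    proof (intro conjI allI impI)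
      fix \<epsilon> p :: real
      assume A: "0 < \<epsilon> \<and> \<epsilon> < 1/2 \<and> 0 < p \<and> p \<le> 1 \<and> ennreal ?C * ennreal (ln (1 / \<epsilon>)) < ennreal (p * real n)"
      \<comment> \<open>Nonnegativity lets the product and the strict inequality in
        \<open>ennreal\<close> be read as real ones.\<close>
      have "0 \<le> ln (1 / \<epsilon>)" using A by (intro ln_ge_zero) (auto simp: field_simps)
      then have "ennreal ?C * ennreal (ln (1 / \<epsilon>)) = ennreal (?C * ln (1 / \<epsilon>))"
        using C0 by (simp only: ennreal_mult)
      then have "?C * ln (1 / \<epsilon>) < p * real n"
        using A C0 \<open>0 \<le> ln (1 / \<epsilon>)\<close> by (metis ennreal_less_iff mult_nonneg_nonneg)
      then show "1 - \<epsilon> \<le> measure_pmf.prob (bernoulli_sample n p) {W. sketch_recovers d n k X \<Gamma> W}"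
        using A by (intro sketch_recovers_probability[OF H(2) k H(3,5,4)]) auto
    qed simp
  qed
  show ?thesis
    unfolding Let_def
  proof (rule exI[of _ F], rule conjI, goal_cases)
    case 1
    show ?case by (intro allI impI, elim conjE, rule mono; assumption)
  next
    case 2
    show ?case by (intro allI impI, rule main; assumption)
  qed
qed

end
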